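(* Let $n\ge 3$, let $A_1A_2\ldots A_n$ be a convex polygon in $\mathbb{R}^2$, let $\gamma_1,\ldots,\gamma_n$ be closed convex curves around its vertices as described in the context, and let $w_1,\ldots,w_n$ be given positive real numbers. Then the problem of finding a point $P\in\mathbb{R}^2$ such that $$\sum_{i=1}^{n} w_i\, d(P,\gamma_i)\to\min$$ has a solution, and this solution is unique.
   Context: Setting: $A_1A_2\ldots A_n$ ($n\ge3$) is a convex polygon in $\mathbb{R}^2$. For each $i$, $\gamma_i$ is a closed convex curve surrounding $A_i$ that meets orthogonally, at points $D_{ij}$ ($j\neq i$), the two sides of the polygon containing $A_i$; the curves $\gamma_i$ do not intersect each other inside the polygon. Segments on the edges of the polygon and $n$ arcs of the curves $\gamma_i$ bound a curvilinear $2n$-gon $\Omega$. $d(P,\gamma_i)$ denotes the Euclidean distance from $P$ to $\gamma_i$.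
   Formalization: The distance d(P,γ_i) is taken to be 0 when P is enclosed by γ_i (Euclidean otherwise), and the closed convex curves are assumed to contain no segments (every line meets each in at most two points); without either change uniqueness can fail. *)

theory Defs
  imports "HOL-Analysis.Analysis"
begin

(* The vertices are A 0, ..., A (n - 1), in cyclic order and in either orientation; v is a
   normal of the line through a side, and all remaining vertices lie strictly on one side of
   that line.  For n >= 3 this forces the vertices to be distinct and no three to be collinear. *)
definition convex_polygon :: "nat \<Rightarrow> (nat \<Rightarrow> real^2) \<Rightarrow> bool" where
  "convex_polygon n A \<longleftrightarrow> n \<ge> 3 \<and>
     (\<forall>i<n. \<exists>v. v \<bullet> (A (Suc i mod n) - A i) = 0 \<and>
        (\<forall>k<n. k \<noteq> i \<and> k \<noteq> Suc i mod n \<longrightarrow> v \<bullet> (A k - A i) > 0))"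

definition polygon_region :: "nat \<Rightarrow> (nat \<Rightarrow> real^2) \<Rightarrow> (real^2) set" where
  "polygon_region n A = convex hull (A ` {..<n})"

(* "Convex curve" is taken in the sense in which a line meets the curve in at most two points.
   If the curves may contain segments, minimizers need not be unique: take an equilateral
   triangle with equal weights and curves whose part facing the centre is flat and parallel to
   the opposite side; the sum of the distances is then constant near the centre. *)
definition closed_convex_curve :: "(real^2) set \<Rightarrow> bool" where
  "closed_convex_curve C \<longleftrightarrow>
     (\<exists>K. compact K \<and> convex K \<and> interior K \<noteq> {} \<and> C = frontier K) \<and>
     (\<forall>x\<in>C. \<forall>y\<in>C. \<forall>z\<in>C. collinear {x, y, z} \<longrightarrow> x = y \<or> y = z \<or> x = z)"

(* C meets the side ab in a single point D, where C has a tangent perpendicular to ab: the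
   directions of the secants through D become perpendicular to ab. *)
definition meets_side_orthogonally :: "(real^2) set \<Rightarrow> real^2 \<Rightarrow> real^2 \<Rightarrow> bool" where
  "meets_side_orthogonally C a b \<longleftrightarrow>
     (\<exists>D. C \<inter> closed_segment a b = {D} \<and>
          ((\<lambda>x. ((x - D) \<bullet> (b - a)) / norm (x - D)) \<longlongrightarrow> 0) (at D within C))"

(* The clause on the other sides, together with disjointness in the polygon, says that
   segments of the sides and exactly one arc of each curve bound a curvilinear 2n-gon. *)
definition vertex_curves :: "nat \<Rightarrow> (nat \<Rightarrow> real^2) \<Rightarrow> (nat \<Rightarrow> (real^2) set) \<Rightarrow> bool" where
  "vertex_curves n A \<gamma> \<longleftrightarrow>
     (\<forall>i<n. closed_convex_curve (\<gamma> i) \<and> A i \<in> inside (\<gamma> i)) \<and>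
     (\<forall>i<n. meets_side_orthogonally (\<gamma> i) (A i) (A (Suc i mod n)) \<and>
            meets_side_orthogonally (\<gamma> (Suc i mod n)) (A (Suc i mod n)) (A i)) \<and>
     (\<forall>i<n. \<forall>k<n. k \<noteq> i \<and> Suc k mod n \<noteq> i \<longrightarrow>
            \<gamma> i \<inter> closed_segment (A k) (A (Suc k mod n)) = {}) \<and>
     (\<forall>i<n. \<forall>j<n. i \<noteq> j \<longrightarrow> \<gamma> i \<inter> \<gamma> j \<inter> polygon_region n A = {})"

(* Convention: points enclosed by the curve have distance 0, which makes the distance a convex
   function of P.  This is a genuine change from infdist P C, under which minimizers need not
   be unique even for circles: take the vertices (0,-1/100), (1,0), (0,1), (-1,0) with weights
   1/10000, 1, 1/1000, 1 and circles of radius 1/10 around them.  The sum is symmetric in the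
   second coordinate axis, and every point on that axis has a larger value than (1/20,0). *)
definition curve_dist :: "real^2 \<Rightarrow> (real^2) set \<Rightarrow> real" where
  "curve_dist P C = (if P \<in> inside C then 0 else infdist P C)"

end

(* The curve gamma i bounds a strictly convex body K i, and curve_dist is the distance to K i.
   Orthogonality makes the nearest-point map onto the polygon send K i into itself, so projecting
   onto the polygon decreases every distance, and strictly at least one: the minimum is attained,
   and only in the polygon.  If P and Q were two minimizers, every distance would be affine along
   PQ; by strict convexity each K i then contains P and Q or has PQ on a normal ray starting at a
   point of the line PQ in the polygon.  For a vertex A i farthest from the line PQ on one of its
   sides, the second case would make that ray meet one of the normal rays of K i carried by the
   sides at A i.  So the bodies at the farthest vertices on either side of the line both contain
   the midpoint of PQ in their interior, which forces their curves to cross inside the polygon. *)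
theory Submission
  imports Defs
begin

section \<open>Strictly convex bodies and distances\<close>

text \<open>Strict convexity of the bodies does not make the sum strictly convex: each distance
  vanishes on its body and is linear along every normal ray. A single body therefore cannot exclude
  a segment of minimizers in its interior or on one of its normal rays; the contradiction has to
  come from the relative position of several bodies. What is known of that position concerns the
  curves, and their disjointness only inside the polygon, and disjoint boundaries would still allow
  nested bodies. So disjointness of the interiors inside the polygon is a topological matter: it
  rests on the connectedness of the arc of a curve in the polygon and on each body avoiding the
  sides not at its vertex. Tangency enters through a single inequality, that the perpendicular to a
  side at the foot supports the body; after that no limits occur.\<close>

lemma midpoint_interior_if_no_collinear_triple:
  fixes K :: "'a::euclidean_space set"
  assumes "convex K" "closed K"
    and strict: "\<And>x y z. x \<in> frontier K \<Longrightarrow> y \<in> frontier K \<Longrightarrow> z \<in> frontier K \<Longrightarrow>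
      collinear {x, y, z} \<Longrightarrow> x = y \<or> y = z \<or> x = z"
    and "x \<in> K" "y \<in> K" "x \<noteq> y"
  shows "midpoint x y \<in> interior K"
proof (rule ccontr)
  assume m: "midpoint x y \<notin> interior K"
  have o: "midpoint x y \<in> open_segment x y" "midpoint x y \<in> open_segment y x"
    using \<open>x \<noteq> y\<close> by (auto simp: midpoint_in_open_segment open_segment_commute)
  have cl: "closure K = K" using assms by simp
  have fr: "z \<in> frontier K" if "z \<in> K" "z \<notin> interior K" for z
    using that cl by (simp add: frontier_def)
  \<comment> \<open>An interior end point would put the open segment, hence the midpoint, into the
    interior. So the ends and the midpoint are three collinear frontier points.\<close>
  have "x \<notin> interior K" "y \<notin> interior K"
    using in_interior_closure_convex_segment[OF \<open>convex K\<close>] m o assms cl by blast+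
  moreover have "midpoint x y \<in> K"
    using assms o by (meson convex_contains_segment segment_open_subset_closed subsetD)
  ultimately have "x = midpoint x y \<or> midpoint x y = y \<or> x = y"
    using strict[of x "midpoint x y" y] fr m assms collinear_midpoint by metis
  then show False using \<open>x \<noteq> y\<close> midpoint_eq_endpoint by metis
qed

lemma infdist_frontier:
  fixes K :: "'a::euclidean_space set"
  assumes "closed K" "K \<noteq> {}" "K \<noteq> UNIV" "P \<notin> interior K"
  shows "infdist P (frontier K) = infdist P K"
proof (rule antisym)
  have ne: "frontier K \<noteq> {}" using assms by (simp add: frontier_eq_empty)
  have sub: "frontier K \<subseteq> K" using assms by (simp add: frontier_subset_closed)
  show "infdist P K \<le> infdist P (frontier K)" by (rule infdist_mono[OF sub ne])
  obtain p where p: "p \<in> K" "infdist P K = dist P p"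
    using infdist_attains_inf[OF assms(1,2)] by blast
  show "infdist P (frontier K) \<le> infdist P K"
  proof (cases "P \<in> K")
    case True
    then have "P \<in> frontier K" using assms by (simp add: frontier_def)
    then show ?thesis by (simp add: infdist_nonneg)
  next
    case False
    have "closed_segment P p \<inter> frontier K \<noteq> {}"
      by (rule connected_Int_frontier) (use p False in auto)
    then obtain z where "z \<in> closed_segment P p" "z \<in> frontier K" by blast
    moreover have "dist P z \<le> dist P p"
      using \<open>z \<in> closed_segment P p\<close> dist_in_closed_segment by (metis dist_commute)
    ultimately show ?thesis using p infdist_le[of z "frontier K" P] by linarith
  qed
qed

lemma infdist_closest_point:
  assumes "closed S" "S \<noteq> {}"
  shows "infdist P S = dist P (closest_point S P)"
  using assms by (simp add: infdist_eq_setdist setdist_closest_point)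

lemma interior_point_beyond:
  fixes K :: "'a::real_normed_vector set"
  assumes "z \<in> interior K" "v \<noteq> 0"
  obtains t where "t > 0" "z + t *\<^sub>R v \<in> K"
proof -
  obtain e where e: "e > 0" "cball z e \<subseteq> K" using assms mem_interior_cball by blast
  show ?thesis
    by (rule that[of "e / norm v"]) (use e assms in \<open>auto simp: subset_iff dist_norm\<close>)
qed

text \<open>A linear functional bounded on \<open>K\<close> cannot reach its bound at an interior
  point, since one can still move a little along \<open>v\<close>.\<close>

lemma interior_inner_less:
  fixes K :: "'a::real_inner set"
  assumes "z \<in> interior K" "v \<noteq> 0" "\<And>x. x \<in> K \<Longrightarrow> (x - D) \<bullet> v \<le> 0"
  shows "(z - D) \<bullet> v < 0"
proof -
  obtain t where "t > 0" "z + t *\<^sub>R v \<in> K" using interior_point_beyond assms by blast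
  then have "(z - D) \<bullet> v + t * (v \<bullet> v) \<le> 0"
    using assms(3)[of "z + t *\<^sub>R v"] by (simp add: algebra_simps)
  moreover have "t * (v \<bullet> v) > 0" using \<open>t > 0\<close> assms by simp
  ultimately show ?thesis by linarith
qed

text \<open>A ray from the interior point \<open>a\<close> that has left the interior never returns:
  \<open>x\<close> lies between \<open>a\<close> and any later point \<open>z\<close>, and the
  interior is convex.\<close>

lemma exit_segment_Int_interior:
  fixes K :: "'a::euclidean_space set"
  assumes "convex K" "a \<in> interior K" "x \<notin> interior K" "x \<in> closed_segment a b"
  shows "closed_segment x b \<inter> interior K = {}"
proof (rule ccontr)
  assume "\<not> ?thesis"
  then obtain z where z: "z \<in> closed_segment x b" "z \<in> interior K" by blast
  have "x \<in> closed_segment a z"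
    using z(1) assms(4) dist_triangle[of a b z] dist_triangle[of a z x]
    by (simp add: between_mem_segment[symmetric] between)
  then show False
    using assms z convex_interior[OF assms(1)] by (meson convex_contains_segment subsetD)
qed

text \<open>If \<open>x \<in> K\<close> lay beyond the line perpendicular to \<open>D - a\<close> through \<open>D\<close>, the convexity of \<open>K\<close>
  would force frontier points near \<open>D\<close> on secants that stay away from that line.\<close>

lemma orthogonal_crossing_halfspace:
  fixes K :: "'a::euclidean_space set"
  assumes "convex K" "closed K" "a \<in> interior K" "D \<in> frontier K"
    and D: "D \<in> closed_segment a b"
    and lim: "((\<lambda>x. ((x - D) \<bullet> (b - a)) / norm (x - D)) \<longlongrightarrow> 0) (at D within frontier K)"
    and "x \<in> K"
  shows "(x - D) \<bullet> (b - a) \<le> 0"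
proof (rule ccontr)
  define e where "e = b - a"
  assume "\<not> ?thesis"
  then have xe: "(x - D) \<bullet> e > 0" by (simp add: e_def)
  have cl: "closure K = K" using assms by simp
  have DK: "D \<in> K" "D \<notin> interior K" using \<open>D \<in> frontier K\<close> cl by (auto simp: frontier_def)
  have "a \<noteq> D" using DK assms by auto
  obtain s where s: "D - a = s *\<^sub>R e" "0 \<le> s" "s \<le> 1"
    using D by (auto simp: in_segment e_def algebra_simps)
  have "s > 0" "e \<noteq> 0" using s \<open>a \<noteq> D\<close> by (auto simp: less_le)
  have "x \<noteq> D" using xe by auto
  \<comment> \<open>For both \<open>D - a\<close> and \<open>x - D\<close> the quotient of the inner
    product with \<open>e\<close> by the norm is at least \<open>\<delta>\<close>; for
    \<open>D - a\<close>, a positive multiple of \<open>e\<close>, it is \<open>norm e\<close>.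
    Nonnegative combinations such as \<open>y - D\<close> inherit the bound, because norms are
    subadditive.\<close>
  define \<delta> where "\<delta> = min (norm e) ((x - D) \<bullet> e / norm (x - D))"
  have "\<delta> > 0" using xe \<open>e \<noteq> 0\<close> \<open>x \<noteq> D\<close> by (simp add: \<delta>_def)
  obtain r where r: "r > 0"
    and rr: "\<And>y. y \<in> frontier K \<Longrightarrow> y \<noteq> D \<Longrightarrow> dist y D < r \<Longrightarrow> \<bar>((y - D) \<bullet> e) / norm (y - D)\<bar> < \<delta>"
    using tendstoD[OF lim \<open>\<delta> > 0\<close>] by (auto simp: eventually_at e_def)
  have beyond: "a + (1 + t) *\<^sub>R (D - a) \<notin> K" if "t > 0" for t
  proof
    assume in_K: "a + (1 + t) *\<^sub>R (D - a) \<in> K"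
    have "D \<in> open_segment a (a + (1 + t) *\<^sub>R (D - a))"
      unfolding in_segment
    proof (intro conjI exI[of _ "1 / (1 + t)"])
      have "(1 + t) *\<^sub>R (D - a) \<noteq> 0" using \<open>t > 0\<close> \<open>a \<noteq> D\<close> by simp
      then show "a \<noteq> a + (1 + t) *\<^sub>R (D - a)" by simp
      have "(1 - c) *\<^sub>R a + c *\<^sub>R (a + (1 + t) *\<^sub>R (D - a)) = a + (c * (1 + t)) *\<^sub>R (D - a)" for c
        by (simp add: algebra_simps)
      then show "D = (1 - 1 / (1 + t)) *\<^sub>R a + (1 / (1 + t)) *\<^sub>R (a + (1 + t) *\<^sub>R (D - a))"
        using \<open>t > 0\<close> by simp
    qed (use \<open>t > 0\<close> in auto)
    then show False
      using in_interior_closure_convex_segment[OF \<open>convex K\<close> \<open>a \<in> interior K\<close>] in_K cl DK by blast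
  qed
  define t where "t = min 1 (r / (2 * norm (D - a)))"
  have "t > 0" "t \<le> 1" "t * norm (D - a) \<le> r / 2"
    using r \<open>a \<noteq> D\<close> by (auto simp: t_def min_def field_simps)
  have "open (- K)" using assms by auto
  then obtain q where q: "q > 0" "ball (a + (1 + t) *\<^sub>R (D - a)) q \<subseteq> - K"
    using beyond[OF \<open>t > 0\<close>] open_contains_ball by blast
  \<comment> \<open>As \<open>1 + t\<close> and \<open>1 + l\<close> are at most 2, the part q/4
    moves the outer end point by at most q/2, so that it stays outside \<open>K\<close>, and the
    part r/8 together with the choice of \<open>t\<close> keeps \<open>y\<close> within 3r/4 of
    \<open>D\<close>.\<close>
  define \<epsilon> where "\<epsilon> = min 1 (min (q / 4) (r / 8) / norm (x - D))"
  have eps: "\<epsilon> > 0" "\<epsilon> \<le> 1" "\<epsilon> * norm (x - D) \<le> q / 4" "\<epsilon> * norm (x - D) \<le> r / 8"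
    using q r \<open>x \<noteq> D\<close> by (auto simp: \<epsilon>_def min_def field_simps)
  define z where "z = D + \<epsilon> *\<^sub>R (x - D)"
  have "z \<in> K"
    using convexD_alt[OF \<open>convex K\<close> DK(1) \<open>x \<in> K\<close>, of \<epsilon>] eps by (simp add: z_def algebra_simps)
  have "a + (1 + t) *\<^sub>R (z - a) \<notin> K"
  proof -
    have "dist (a + (1 + t) *\<^sub>R (D - a)) (a + (1 + t) *\<^sub>R (z - a)) = norm ((1 + t) *\<^sub>R (\<epsilon> *\<^sub>R (x - D)))"
      by (subst dist_commute) (simp add: z_def dist_norm algebra_simps)
    also have "\<dots> = (1 + t) * (\<epsilon> * norm (x - D))" using eps \<open>t > 0\<close> by simp
    also have "\<dots> \<le> 2 * (q / 4)" by (intro mult_mono) (use eps \<open>t > 0\<close> \<open>t \<le> 1\<close> q in auto)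
    also have "\<dots> < q" using q by simp
    finally have "a + (1 + t) *\<^sub>R (z - a) \<in> ball (a + (1 + t) *\<^sub>R (D - a)) q"
      by (simp only: mem_ball)
    then show ?thesis using q(2) by blast
  qed
  then have "closed_segment z (a + (1 + t) *\<^sub>R (z - a)) \<inter> frontier K \<noteq> {}"
    by (intro connected_Int_frontier) (use \<open>z \<in> K\<close> in auto)
  then obtain y where y: "y \<in> closed_segment z (a + (1 + t) *\<^sub>R (z - a))" "y \<in> frontier K" by blast
  then obtain c where c: "0 \<le> c" "c \<le> 1" "y = (1 - c) *\<^sub>R z + c *\<^sub>R (a + (1 + t) *\<^sub>R (z - a))"
    by (auto simp: in_segment)
  define l where "l = c * t"
  have l: "0 \<le> l" "l \<le> t" using c \<open>t > 0\<close> by (auto simp: l_def mult_left_le_one_le)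
  have "y = a + (1 + l) *\<^sub>R (z - a)" using c by (simp add: l_def algebra_simps)
  then have yD: "y - D = l *\<^sub>R (D - a) + ((1 + l) * \<epsilon>) *\<^sub>R (x - D)" by (simp add: z_def algebra_simps)
  have se: "(D - a) \<bullet> e = norm (D - a) * norm e"
    using s by (simp add: power2_norm_eq_inner[symmetric] power2_eq_square)
  have num: "(y - D) \<bullet> e = l * (norm (D - a) * norm e) + ((1 + l) * \<epsilon>) * ((x - D) \<bullet> e)"
    unfolding yD by (simp only: inner_add_left inner_scaleR_left se)
  have nle: "norm (y - D) \<le> l * norm (D - a) + ((1 + l) * \<epsilon>) * norm (x - D)"
    unfolding yD using norm_triangle_ineq[of "l *\<^sub>R (D - a)" "((1 + l) * \<epsilon>) *\<^sub>R (x - D)"] l eps by simp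
  have "((1 + l) * \<epsilon>) * ((x - D) \<bullet> e) > 0" using l eps xe by simp
  then have "(y - D) \<bullet> e > 0" using num l by (simp add: add_nonneg_pos)
  then have "y \<noteq> D" by auto
  have "l * norm (D - a) \<le> r / 2"
    using \<open>t * norm (D - a) \<le> r / 2\<close> l by (meson mult_right_mono norm_ge_zero order_trans)
  moreover have "((1 + l) * \<epsilon>) * norm (x - D) \<le> 2 * (r / 8)"
    unfolding mult.assoc by (intro mult_mono) (use l eps \<open>t \<le> 1\<close> r in auto)
  ultimately have "dist y D < r" using nle r by (simp add: dist_norm)
  have "\<delta> * norm (y - D) \<le> \<delta> * (l * norm (D - a) + ((1 + l) * \<epsilon>) * norm (x - D))"
    using nle \<open>\<delta> > 0\<close> by simp
  also have "\<dots> = l * norm (D - a) * \<delta> + ((1 + l) * \<epsilon>) * (\<delta> * norm (x - D))" by (simp add: algebra_simps)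
  also have "\<dots> \<le> l * norm (D - a) * norm e + ((1 + l) * \<epsilon>) * ((x - D) \<bullet> e)"
  proof (intro add_mono mult_left_mono)
    show "\<delta> * norm (x - D) \<le> (x - D) \<bullet> e" using \<open>x \<noteq> D\<close> by (simp add: \<delta>_def min_def field_simps)
  qed (use l eps in \<open>auto simp: \<delta>_def\<close>)
  also have "\<dots> = (y - D) \<bullet> e" using num by simp
  finally have "\<delta> \<le> ((y - D) \<bullet> e) / norm (y - D)" using \<open>y \<noteq> D\<close> by (simp add: field_simps)
  then show False using rr[OF y(2) \<open>y \<noteq> D\<close> \<open>dist y D < r\<close>] by linarith
qed

section \<open>Supporting hyperplanes and nearest points\<close>

lemma supporting_hyperplane_not_interior:
  fixes S :: "'a::euclidean_space set"
  assumes "convex S" "x \<in> S" "x \<notin> interior S"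
  obtains v where "v \<noteq> 0" "\<And>y. y \<in> S \<Longrightarrow> v \<bullet> y \<le> v \<bullet> x"
proof (cases "interior S = {}")
  \<comment> \<open>A flat \<open>S\<close> needs its own case: \<open>x\<close> may lie in its
    relative interior, but a hyperplane containing \<open>S\<close> supports it trivially.\<close>
  case True
  then obtain v c where "v \<noteq> 0" "S \<subseteq> {y. v \<bullet> y = c}"
    using empty_interior_subset_hyperplane[OF assms(1)] by blast
  then have "v \<bullet> y = v \<bullet> x" if "y \<in> S" for y using that assms(2) by blast
  then show ?thesis using that[of v] \<open>v \<noteq> 0\<close> by simp
next
  case False
  then have "x \<notin> rel_interior S" using assms by (simp add: rel_interior_nonempty_interior)
  then obtain v where "v \<noteq> 0" "\<And>y. y \<in> S \<Longrightarrow> v \<bullet> x \<le> v \<bullet> y"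
    using supporting_hyperplane_rel_boundary[OF assms(1,2)] by metis
  then show ?thesis using that[of "- v"] by auto
qed

text \<open>The equality case of nonexpansiveness. Expanding the square of \<open>x - y\<close>
  around the nearest points leaves two cross terms, both of favourable sign by the obtuse angle
  criterion; equality makes them vanish.\<close>

lemma closest_point_dist_eq:
  fixes S :: "'a::euclidean_space set"
  assumes "convex S" "closed S" "S \<noteq> {}"
    and "dist x y \<le> dist (closest_point S x) (closest_point S y)"
  shows "(x - closest_point S x) \<bullet> (closest_point S y - closest_point S x) = 0"
proof -
  define x' y' where "x' = closest_point S x" and "y' = closest_point S y"
  have in_S: "x' \<in> S" "y' \<in> S" using assms by (auto simp: x'_def y'_def closest_point_in_set)
  have 1: "(x - x') \<bullet> (y' - x') \<le> 0" "(y - y') \<bullet> (x' - y') \<le> 0"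
    using closest_point_dot[OF assms(1,2)] in_S by (auto simp: x'_def y'_def)
  have "norm (x - y) \<le> norm (x' - y')" using assms(4) by (simp add: x'_def y'_def dist_norm)
  then have "(norm (x - y))\<^sup>2 \<le> (norm (x' - y'))\<^sup>2" by simp
  then have "(x - y) \<bullet> (x - y) \<le> (x' - y') \<bullet> (x' - y')" by (simp add: power2_norm_eq_inner)
  moreover have "(x - y) \<bullet> (x - y) = (x' - y') \<bullet> (x' - y') + ((x - x') - (y - y')) \<bullet> ((x - x') - (y - y'))
      - 2 * ((x - x') \<bullet> (y' - x')) - 2 * ((y - y') \<bullet> (x' - y'))"
    by (simp add: algebra_simps inner_commute)
  moreover have "((x - x') - (y - y')) \<bullet> ((x - x') - (y - y')) \<ge> 0" by simp
  ultimately have "(x - x') \<bullet> (y' - x') = 0" using 1 by linarith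
  then show ?thesis by (simp add: x'_def y'_def)
qed

lemma dist_midpoints_le:
  fixes P Q p q :: "'a::real_normed_vector"
  shows "dist (midpoint P Q) (midpoint p q) \<le> (dist P p + dist Q q) / 2"
proof -
  have "midpoint P Q - midpoint p q = (1 / 2) *\<^sub>R ((P - p) + (Q - q))"
    by (simp add: midpoint_def algebra_simps)
  then show ?thesis using norm_triangle_ineq[of "P - p" "Q - q"] by (simp add: dist_norm)
qed

text \<open>By convexity of the distance, the last hypothesis holds when the distance is affine on \<open>PQ\<close>.\<close>

lemma infdist_midpoint_cases:
  fixes K :: "'a::euclidean_space set"
  assumes "convex K" "closed K" "K \<noteq> {}"
    and strict: "\<And>x y. x \<in> K \<Longrightarrow> y \<in> K \<Longrightarrow> x \<noteq> y \<Longrightarrow> midpoint x y \<in> interior K"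
    and "P \<noteq> Q"
    and ge: "infdist P K + infdist Q K \<le> 2 * infdist (midpoint P Q) K"
  obtains (inside) "P \<in> K" "Q \<in> K"
    | (ray) p u a b where "p = closest_point K P" "u = Q - P \<or> u = P - Q" "P = p + a *\<^sub>R u"
        "Q = p + b *\<^sub>R u" "0 \<le> a" "0 \<le> b" "\<And>x. x \<in> K \<Longrightarrow> (x - p) \<bullet> u \<le> 0"
proof (cases "P \<in> K \<and> Q \<in> K")
  case True
  then show ?thesis using inside by blast
next
  case False
  define p q M where "p = closest_point K P" and "q = closest_point K Q" and "M = midpoint P Q"
  have pq: "p \<in> K" "q \<in> K" using assms by (auto simp: p_def q_def closest_point_in_set)
  have dP: "infdist P K = dist P p" and dQ: "infdist Q K = dist Q q"
    using assms by (auto simp: p_def q_def infdist_closest_point)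
  have M_le: "infdist M K \<le> dist M x" if "x \<in> K" for x using that by (simp add: infdist_le)
  have dM: "dist M (midpoint p q) \<le> (dist P p + dist Q q) / 2"
    unfolding M_def by (rule dist_midpoints_le)
  \<comment> \<open>Otherwise the interior point \<open>midpoint p q\<close> would be a nearest
    point of \<open>K\<close> to \<open>M\<close>, which is possible only if it equals
    \<open>M\<close>. Then all distances in \<open>ge\<close> are 0, although \<open>P\<close> or
    \<open>Q\<close> lies outside \<open>K\<close>.\<close>
  have "p = q"
  proof (rule ccontr)
    assume "p \<noteq> q"
    then have m: "midpoint p q \<in> interior K" using strict pq by blast
    then have mK: "midpoint p q \<in> K" using interior_subset by blast
    have "M = midpoint p q"
    proof (rule ccontr)
      assume ne: "M \<noteq> midpoint p q"
      have "(M - midpoint p q) \<bullet> (x - midpoint p q) \<le> 0" if "x \<in> K" for x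
        by (rule any_closest_point_dot[OF assms(1,2) mK that])
          (use ge dP dQ dM M_le M_def in force)
      then have "(midpoint p q - midpoint p q) \<bullet> (M - midpoint p q) < 0"
        using interior_inner_less[OF m, of "M - midpoint p q" "midpoint p q"] ne
        by (simp add: inner_commute)
      then show False by simp
    qed
    then have "infdist P K + infdist Q K \<le> 0" using ge mK M_def by simp
    then have "infdist P K = 0" "infdist Q K = 0"
      using infdist_nonneg[of P K] infdist_nonneg[of Q K] by linarith+
    then show False using False assms in_closed_iff_infdist_zero by blast
  qed
  \<comment> \<open>With the common nearest point \<open>p\<close>, the hypothesis \<open>ge\<close>
    gives equality in the triangle inequality for \<open>x\<close> and \<open>y\<close>, so both lie
    on one ray from 0.\<close>
  define x y where "x = P - p" and "y = Q - p"
  have "2 * dist M p \<ge> norm x + norm y"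
    using M_le[OF pq(1)] ge dP dQ \<open>p = q\<close> by (simp add: M_def x_def y_def dist_norm)
  moreover have "x + y = 2 *\<^sub>R (M - p)" by (simp add: x_def y_def M_def midpoint_def algebra_simps scaleR_2)
  ultimately have "norm (x + y) = norm x + norm y"
    using norm_triangle_ineq[of x y] by (simp add: dist_norm)
  then have par: "norm x *\<^sub>R y = norm y *\<^sub>R x" by (simp add: norm_triangle_eq)
  have "x \<noteq> y" using assms by (simp add: x_def y_def)
  have dots: "x \<bullet> (z - p) \<le> 0" "y \<bullet> (z - p) \<le> 0" if "z \<in> K" for z
    using closest_point_dot[OF assms(1,2) that, of P] closest_point_dot[OF assms(1,2) that, of Q] \<open>p = q\<close>
    by (auto simp: x_def y_def p_def q_def)
  \<comment> \<open>\<open>v\<close> is the shorter of the two vectors, so \<open>u\<close> is a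
    positive multiple of \<open>v'\<close> and points along the ray away from
    \<open>p\<close>.\<close>
  have res: thesis
    if less: "norm v < norm v'" and u: "u = Q - P \<or> u = P - Q" and vv: "norm v *\<^sub>R v' = norm v' *\<^sub>R v"
      "u = v' - v" and P: "v = x \<and> v' = y \<or> v = y \<and> v' = x"
    for v v' u
  proof -
    have pos: "norm v' > 0" using less norm_ge_zero[of v] by linarith
    have v: "v = (norm v / norm v') *\<^sub>R v'" using vv(1) pos
      by (metis divide_inverse inverse_eq_divide mult.commute norm_eq_zero order_less_irrefl scaleR_scaleR vector_fraction_eq_iff)
    have u': "u = (1 - norm v / norm v') *\<^sub>R v'" using v vv(2)
      by (metis scaleR_left.diff scaleR_one)
    define c where "c = 1 - norm v / norm v'"
    have c: "c > 0" using less pos by (simp add: c_def field_simps)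
    have v': "v' = (1 / c) *\<^sub>R u" using u' c by (simp add: c_def[symmetric])
    then have v2: "v = (norm v / norm v' / c) *\<^sub>R u" using v by (metis mult.right_neutral scaleR_scaleR times_divide_eq_right)
    have n: "(z - p) \<bullet> u \<le> 0" if "z \<in> K" for z
    proof -
      have "v' \<bullet> (z - p) \<le> 0" using dots[OF that] P by auto
      then show ?thesis using u' c by (simp add: c_def[symmetric] inner_commute mult_le_0_iff)
    qed
    have PQ: "P = p + x" "Q = p + y" by (auto simp: x_def y_def)
    have nn: "0 \<le> norm v / norm v' / c" "0 \<le> 1 / c" using c by auto
    show thesis
    proof (cases "v = x")
      case True
      then have "v' = y" using P \<open>x \<noteq> y\<close> by auto
      then show ?thesis using ray[OF p_def u _ _ nn n] PQ v2 v' True by metis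
    next
      case False
      then have "v = y" "v' = x" using P by auto
      then show ?thesis using ray[OF p_def u _ _ nn(2,1) n] PQ v2 v' by metis
    qed
  qed
  have "norm x \<noteq> norm y"
  proof
    assume eq: "norm x = norm y"
    then show False using par \<open>x \<noteq> y\<close> by auto
  qed
  then consider "norm x < norm y" | "norm y < norm x" by linarith
  then show ?thesis
  proof cases
    case 1
    have "Q - P = y - x" by (simp add: x_def y_def)
    then show ?thesis using res[OF 1 _ par, of "Q - P"] by blast
  next
    case 2
    have "P - Q = x - y" by (simp add: x_def y_def)
    then show ?thesis using res[OF 2 _ par[symmetric], of "P - Q"] by blast
  qed
qed

text \<open>\<open>v'\<close> annihilates \<open>e'\<close> and so reads off the coefficient of
  \<open>e\<close>; \<open>v\<close> does the same for \<open>e'\<close>. The identity for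
  \<open>\<Delta>\<close> is multiplicativity of the 2x2 determinant: it makes \<open>v\<close> and
  \<open>v'\<close> independent, so the error \<open>d\<close>, orthogonal to both, is 0.\<close>

lemma two_normals_coordinates:
  fixes v v' e e' x :: "real^2"
  assumes "v \<bullet> e = 0" "v \<bullet> e' \<noteq> 0" "v' \<bullet> e' = 0" "v' \<bullet> e \<noteq> 0"
  shows "x = (v' \<bullet> x / (v' \<bullet> e)) *\<^sub>R e + (v \<bullet> x / (v \<bullet> e')) *\<^sub>R e'"
proof -
  define d where "d = x - ((v' \<bullet> x / (v' \<bullet> e)) *\<^sub>R e + (v \<bullet> x / (v \<bullet> e')) *\<^sub>R e')"
  have "v \<bullet> d = 0" "v' \<bullet> d = 0"
    using assms by (auto simp: d_def inner_diff_right inner_add_right)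
  then have d: "v$1 * d$1 + v$2 * d$2 = 0" "v'$1 * d$1 + v'$2 * d$2 = 0"
    by (auto simp: inner_vec_def sum_2)
  define \<Delta> where "\<Delta> = v$1 * v'$2 - v$2 * v'$1"
  have "\<Delta> * (e$1 * e'$2 - e$2 * e'$1) = (v \<bullet> e) * (v' \<bullet> e') - (v \<bullet> e') * (v' \<bullet> e)"
    by (simp add: \<Delta>_def inner_vec_def sum_2 algebra_simps)
  then have "\<Delta> \<noteq> 0" using assms by auto
  moreover have "\<Delta> * d$1 = v'$2 * (v$1 * d$1 + v$2 * d$2) - v$2 * (v'$1 * d$1 + v'$2 * d$2)"
    "\<Delta> * d$2 = v$1 * (v'$1 * d$1 + v'$2 * d$2) - v'$1 * (v$1 * d$1 + v$2 * d$2)"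
    by (auto simp: \<Delta>_def algebra_simps)
  ultimately have "d$1 = 0" "d$2 = 0" unfolding d by auto
  then have "d = 0" by (simp add: vec_eq_iff forall_2)
  then show ?thesis by (simp add: d_def)
qed

section \<open>Convex bodies around the vertices of a convex polygon\<close>

text \<open>The bodies take the place of the curves. The two foot assumptions treat the two ends of
  the side that starts at \<open>A i\<close>; their half-plane is what
  \<open>orthogonal_crossing_halfspace\<close> extracts from tangency.\<close>

locale curved_polygon =
  fixes n :: nat and A :: "nat \<Rightarrow> real^2" and K :: "nat \<Rightarrow> (real^2) set"
  assumes polygon: "convex_polygon n A"
    and compact_K: "\<And>i. i < n \<Longrightarrow> compact (K i)"
    and convex_K: "\<And>i. i < n \<Longrightarrow> convex (K i)"
    and strict_K: "\<And>i x y. i < n \<Longrightarrow> x \<in> K i \<Longrightarrow> y \<in> K i \<Longrightarrow> x \<noteq> y \<Longrightarrow> midpoint x y \<in> interior (K i)"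
    and vertex_interior: "\<And>i. i < n \<Longrightarrow> A i \<in> interior (K i)"
    and foot_next: "\<And>i. i < n \<Longrightarrow> \<exists>D. frontier (K i) \<inter> closed_segment (A i) (A (Suc i mod n)) = {D} \<and>
      (\<forall>x\<in>K i. (x - D) \<bullet> (A (Suc i mod n) - A i) \<le> 0)"
    and foot_prev: "\<And>i. i < n \<Longrightarrow> \<exists>D. frontier (K (Suc i mod n)) \<inter> closed_segment (A (Suc i mod n)) (A i) = {D} \<and>
      (\<forall>x\<in>K (Suc i mod n). (x - D) \<bullet> (A i - A (Suc i mod n)) \<le> 0)"
    and frontier_away: "\<And>i k. i < n \<Longrightarrow> k < n \<Longrightarrow> k \<noteq> i \<Longrightarrow> Suc k mod n \<noteq> i \<Longrightarrow>
      frontier (K i) \<inter> closed_segment (A k) (A (Suc k mod n)) = {}"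
    and frontiers_disjoint: "\<And>i j. i < n \<Longrightarrow> j < n \<Longrightarrow> i \<noteq> j \<Longrightarrow>
      frontier (K i) \<inter> frontier (K j) \<inter> polygon_region n A = {}"
begin

abbreviation "region \<equiv> polygon_region n A"

definition nx :: "nat \<Rightarrow> nat" where "nx i = Suc i mod n"
definition pv :: "nat \<Rightarrow> nat" where "pv i = (i + n - 1) mod n"

abbreviation "side k \<equiv> closed_segment (A k) (A (nx k))"

definition neighbours :: "nat \<Rightarrow> nat \<Rightarrow> nat \<Rightarrow> bool" where
  "neighbours i a b \<longleftrightarrow> i < n \<and> (a = nx i \<and> b = pv i \<or> a = pv i \<and> b = nx i)"

section \<open>Cyclic indices\<close>

lemma n_ge_3: "n \<ge> 3" using polygon by (simp add: convex_polygon_def)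

lemma index_cases:
  assumes "i < n"
  shows "nx i < n" "pv i < n" "nx (pv i) = i" "pv (nx i) = i" "nx i \<noteq> i" "pv i \<noteq> i" "nx i \<noteq> pv i"
proof -
  have nx: "nx i = (if i = n - 1 then 0 else Suc i)" if "i < n" for i
    using that n_ge_3 by (auto simp: nx_def mod_Suc)
  have pv: "pv i = (if i = 0 then n - 1 else i - 1)" if "i < n" for i
  proof (cases i)
    case 0 then show ?thesis using n_ge_3 by (simp add: pv_def)
  next
    case (Suc m) then show ?thesis using that by (simp add: pv_def)
  qed
  show "nx i < n" "pv i < n" using nx pv assms n_ge_3 by auto
  then show "nx (pv i) = i" "pv (nx i) = i" "nx i \<noteq> i" "pv i \<noteq> i" "nx i \<noteq> pv i"
    using nx[of i] pv[of i] nx[of "pv i"] pv[of "nx i"] assms n_ge_3 by (auto split: if_splits)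
qed

lemma neighbours_sym: "neighbours i a b \<longleftrightarrow> neighbours i b a"
  by (auto simp: neighbours_def)

lemma neighbours_less: "neighbours i a b \<Longrightarrow> i < n \<and> a < n \<and> b < n \<and> a \<noteq> i \<and> b \<noteq> i \<and> a \<noteq> b"
  using index_cases by (auto simp: neighbours_def) metis+

lemma closed_K: "i < n \<Longrightarrow> closed (K i)" and K_nonempty: "i < n \<Longrightarrow> K i \<noteq> {}"
  using compact_K compact_imp_closed vertex_interior interior_subset by blast+

lemma vertex_in_K: "i < n \<Longrightarrow> A i \<in> K i"
  using vertex_interior interior_subset by blast

lemma frontier_K: "i < n \<Longrightarrow> frontier (K i) = K i - interior (K i)"
  using closed_K by (simp add: frontier_def)

section \<open>The polygon, its corners and its supporting lines\<close>

lemma compact_region: "compact region" and convex_region: "convex region"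
  by (auto simp: polygon_region_def intro!: finite_imp_compact_convex_hull)

lemma closed_region: "closed region" using compact_region by (rule compact_imp_closed)

lemma vertex_in_region: "i < n \<Longrightarrow> A i \<in> region"
  by (auto simp: polygon_region_def intro: hull_inc)

lemma region_nonempty: "region \<noteq> {}" using vertex_in_region[of 0] n_ge_3 by auto

lemma side_in_region: "k < n \<Longrightarrow> side k \<subseteq> region"
  using convex_region vertex_in_region index_cases(1) convex_contains_segment by blast

lemma region_halfspace:
  assumes "\<And>k. k < n \<Longrightarrow> v \<bullet> (A k - c) \<ge> 0" "x \<in> region"
  shows "v \<bullet> (x - c) \<ge> 0"
proof -
  have "region \<subseteq> {x. v \<bullet> x \<ge> v \<bullet> c}"
    unfolding polygon_region_def
    by (rule hull_minimal) (use assms(1) in \<open>auto simp: convex_halfspace_ge inner_diff_right\<close>)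
  then show ?thesis using assms(2) by (auto simp: inner_diff_right)
qed

lemma side_normal:
  assumes "k < n"
  obtains v where "v \<bullet> (A (nx k) - A k) = 0"
    "\<And>j. j < n \<Longrightarrow> j \<noteq> k \<Longrightarrow> j \<noteq> nx k \<Longrightarrow> v \<bullet> (A j - A k) > 0"
    "\<And>x. x \<in> region \<Longrightarrow> v \<bullet> (x - A k) \<ge> 0"
proof -
  obtain v where v: "v \<bullet> (A (nx k) - A k) = 0"
    "\<And>j. j < n \<Longrightarrow> j \<noteq> k \<Longrightarrow> j \<noteq> nx k \<Longrightarrow> v \<bullet> (A j - A k) > 0"
    using polygon assms unfolding convex_polygon_def nx_def by metis
  have "v \<bullet> (A j - A k) \<ge> 0" if "j < n" for j
    using v that by (cases "j = k"; cases "j = nx k") (auto simp: less_imp_le)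
  then show ?thesis using that v region_halfspace by blast
qed

text \<open>\<open>v\<close> and \<open>v'\<close> are inner normals of the sides to
  \<open>A a\<close> and to \<open>A b\<close>. Through \<open>two_normals_coordinates\<close> they
  give oblique coordinates along the two sides, nonnegative on the polygon.\<close>

lemma corner:
  assumes "neighbours i a b"
  obtains v v' where "v \<bullet> (A a - A i) = 0" "v \<bullet> (A b - A i) > 0"
    "v' \<bullet> (A b - A i) = 0" "v' \<bullet> (A a - A i) > 0"
    "\<And>x. x \<in> region \<Longrightarrow> v \<bullet> (x - A i) \<ge> 0" "\<And>x. x \<in> region \<Longrightarrow> v' \<bullet> (x - A i) \<ge> 0"
proof -
  have i: "i < n" using assms neighbours_def by simp
  note ix = index_cases[OF i]
  obtain v where v: "v \<bullet> (A (nx i) - A i) = 0" "v \<bullet> (A (pv i) - A i) > 0"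
    "\<And>x. x \<in> region \<Longrightarrow> v \<bullet> (x - A i) \<ge> 0"
    using side_normal[OF i] ix by metis
  obtain w where w: "w \<bullet> (A i - A (pv i)) = 0" "w \<bullet> (A (nx i) - A (pv i)) > 0"
    "\<And>x. x \<in> region \<Longrightarrow> w \<bullet> (x - A (pv i)) \<ge> 0"
    using side_normal[OF ix(2)] ix by metis
  have *: "w \<bullet> (x - A i) = w \<bullet> (x - A (pv i))" for x using w(1) by (simp add: inner_diff_right)
  have w': "w \<bullet> (A (pv i) - A i) = 0" "w \<bullet> (A (nx i) - A i) > 0"
    "\<And>x. x \<in> region \<Longrightarrow> w \<bullet> (x - A i) \<ge> 0" using w unfolding * by auto
  consider "a = nx i" "b = pv i" | "a = pv i" "b = nx i" using assms neighbours_def by auto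
  then show ?thesis
  proof cases
    case 1 then show ?thesis using that[of v w] v w' by auto
  next
    case 2 then show ?thesis using that[of w v] v w' by auto
  qed
qed

lemma supported_point_in_side:
  assumes nb: "neighbours i a b" and v: "v \<bullet> (A a - A i) = 0" "v \<bullet> (A b - A i) > 0"
    and x: "x \<in> region" "v \<bullet> (x - A i) = 0"
  shows "x \<in> closed_segment (A i) (A a)"
proof -
  obtain v' where v': "v' \<bullet> (A b - A i) = 0" "v' \<bullet> (A a - A i) > 0"
    "\<And>x. x \<in> region \<Longrightarrow> v' \<bullet> (x - A i) \<ge> 0" using corner[OF nb] by metis
  define s where "s = v' \<bullet> (x - A i) / (v' \<bullet> (A a - A i))"
  have xs: "x - A i = s *\<^sub>R (A a - A i)"
    using two_normals_coordinates[of v "A a - A i" "A b - A i" v' "x - A i"] v v' x by (simp add: s_def)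
  have "s \<ge> 0" using v' x by (simp add: s_def)
  \<comment> \<open>The normal of the other side at \<open>A a\<close> bounds the coordinate
    \<open>s\<close> from above, as \<open>v'\<close> bounds it from below.\<close>
  have "\<exists>c. neighbours a i c"
    using nb index_cases by (auto simp: neighbours_def)
  then obtain w where w: "w \<bullet> (A i - A a) > 0" "w \<bullet> (x - A a) \<ge> 0"
    using corner x(1) by metis
  have "x - A a = (1 - s) *\<^sub>R (A i - A a)"
    using xs by (simp add: algebra_simps)
  then have "(1 - s) * (w \<bullet> (A i - A a)) \<ge> 0" using w(2) by simp
  then have "s \<le> 1" using w(1) by (simp add: zero_le_mult_iff)
  moreover have "x = (1 - s) *\<^sub>R A i + s *\<^sub>R A a" using xs by (simp add: algebra_simps)
  ultimately show ?thesis using \<open>s \<ge> 0\<close> by (auto simp: in_segment)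
qed

lemma maximal_vertex:
  obtains i where "i < n" "\<And>x. x \<in> region \<Longrightarrow> \<nu> \<bullet> x \<le> \<nu> \<bullet> A i"
proof -
  have "finite {..<n}" "{..<n} \<noteq> {}" using n_ge_3 by (auto simp: lessThan_empty_iff)
  then obtain i where i: "i < n" "\<And>k. k < n \<Longrightarrow> \<nu> \<bullet> A k \<le> \<nu> \<bullet> A i"
    using arg_min_if_finite[of "{..<n}" "\<lambda>k. - (\<nu> \<bullet> A k)"] by (metis lessThan_iff neg_less_iff_less not_le)
  have "\<nu> \<bullet> x \<le> \<nu> \<bullet> A i" if "x \<in> region" for x
    using region_halfspace[of "- \<nu>" "A i" x] i that by (simp add: inner_diff_right)
  then show ?thesis using that i by blast
qed

text \<open>One side serves all maximizers at once. At a maximal vertex the slopes \<open>p\<close>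
  and \<open>q\<close> of \<open>\<nu>\<close> along the two sides are at most 0 and not both 0; a
  negative slope forces the corresponding coordinate of every maximizer to vanish.\<close>

lemma supporting_line_side:
  assumes "\<nu> \<noteq> 0"
  obtains k where "k < n" "\<And>x. x \<in> region \<Longrightarrow> (\<And>y. y \<in> region \<Longrightarrow> \<nu> \<bullet> y \<le> \<nu> \<bullet> x) \<Longrightarrow> x \<in> side k"
proof -
  obtain i where i: "i < n" "\<And>x. x \<in> region \<Longrightarrow> \<nu> \<bullet> x \<le> \<nu> \<bullet> A i" using maximal_vertex by blast
  define a b where "a = nx i" and "b = pv i"
  have nb: "neighbours i a b" using i by (simp add: neighbours_def a_def b_def)
  obtain v v' where v: "v \<bullet> (A a - A i) = 0" "v \<bullet> (A b - A i) > 0"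
    "v' \<bullet> (A b - A i) = 0" "v' \<bullet> (A a - A i) > 0"
    "\<And>x. x \<in> region \<Longrightarrow> v \<bullet> (x - A i) \<ge> 0" "\<And>x. x \<in> region \<Longrightarrow> v' \<bullet> (x - A i) \<ge> 0"
    using corner[OF nb] by metis
  note coord = two_normals_coordinates[of v "A a - A i" "A b - A i" v']
  define p q where "p = \<nu> \<bullet> (A a - A i)" and "q = \<nu> \<bullet> (A b - A i)"
  have pq: "p \<le> 0" "q \<le> 0"
    using i vertex_in_region neighbours_less[OF nb] by (auto simp: p_def q_def inner_diff_right)
  have val: "\<nu> \<bullet> y = (v' \<bullet> y / (v' \<bullet> (A a - A i))) * p + (v \<bullet> y / (v \<bullet> (A b - A i))) * q" for y
    using arg_cong[OF coord[of y], of "\<lambda>z. \<nu> \<bullet> z"] v by (simp add: inner_add_right p_def q_def)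
  have "p < 0 \<or> q < 0" using val[of \<nu>] pq assms by (auto simp: less_le)
  have max0: "\<nu> \<bullet> (x - A i) = 0" if "x \<in> region" "\<And>y. y \<in> region \<Longrightarrow> \<nu> \<bullet> y \<le> \<nu> \<bullet> x" for x
    using that(2)[OF vertex_in_region[OF i(1)]] i(2)[OF that(1)] by (simp add: inner_diff_right)
  have zero: "(v' \<bullet> (x - A i)) * p = 0 \<and> (v \<bullet> (x - A i)) * q = 0"
    if "x \<in> region" "\<nu> \<bullet> (x - A i) = 0" for x
  proof -
    have "(v' \<bullet> (x - A i) / (v' \<bullet> (A a - A i))) * p \<le> 0" "(v \<bullet> (x - A i) / (v \<bullet> (A b - A i))) * q \<le> 0"
      using v pq that by (auto intro!: mult_nonneg_nonpos divide_nonneg_pos simp del: times_divide_eq_left)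
    then have "(v' \<bullet> (x - A i) / (v' \<bullet> (A a - A i))) * p = 0" "(v \<bullet> (x - A i) / (v \<bullet> (A b - A i))) * q = 0"
      using val[of "x - A i"] that by linarith+
    then show ?thesis using v by simp
  qed
  show ?thesis
  proof (cases "q < 0")
    case True
    then show ?thesis
      using that[OF i(1)] supported_point_in_side[OF nb v(1,2)] max0 zero by (force simp: a_def)
  next
    case False
    then have "p < 0" using \<open>p < 0 \<or> q < 0\<close> by simp
    then show ?thesis
      using that[of b] supported_point_in_side[of i b a v'] nb v(3,4) max0 zero index_cases[OF i(1)]
      by (force simp: b_def neighbours_sym closed_segment_commute)
  qed
qed

section \<open>Sides that meet or avoid a body\<close>

lemma foot:
  assumes "neighbours i a b"
  obtains D where "frontier (K i) \<inter> closed_segment (A i) (A a) = {D}"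
    "\<And>x. x \<in> K i \<Longrightarrow> (x - D) \<bullet> (A a - A i) \<le> 0"
proof -
  have i: "i < n" using assms neighbours_def by simp
  consider "a = nx i" | "a = pv i" using assms neighbours_def by auto
  then show ?thesis
  proof cases
    case 1 then show ?thesis using that foot_next[OF i] by (auto simp: nx_def)
  next
    case 2
    have "Suc (pv i) mod n = i" using index_cases(3)[OF i] by (simp add: nx_def)
    then show ?thesis using that foot_prev[OF index_cases(2)[OF i]] 2 by auto
  qed
qed

definition away :: "nat \<Rightarrow> nat set" where
  "away i = {k. k < n \<and> k \<noteq> i \<and> nx k \<noteq> i}"

text \<open>The sides not at \<open>A i\<close> form a chain, along which the later inductions run.
  The last offset is \<open>n - 2\<close>, since the side with offset \<open>n - 1\<close> ends at
  \<open>A i\<close>.\<close>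

lemma away_eq:
  assumes "i < n"
  shows "away i = (\<lambda>m. (i + m) mod n) ` {1..<n - 1}"
proof (intro equalityI subsetI)
  fix k assume "k \<in> away i"
  then have k: "k < n" "k \<noteq> i" "nx k \<noteq> i" by (auto simp: away_def)
  show "k \<in> (\<lambda>m. (i + m) mod n) ` {1..<n - 1}"
  proof (cases "k > i")
    case True
    have "k - i < n - 1"
    proof (rule ccontr)
      assume "\<not> ?thesis"
      then have "k = n - 1" "i = 0" using True k(1) by auto
      then show False using k n_ge_3 by (simp add: nx_def)
    qed
    then show ?thesis using True k by (intro image_eqI[of _ _ "k - i"]) auto
  next
    case False
    have "k + n - i < n - 1"
    proof (rule ccontr)
      assume "\<not> ?thesis"
      then have "Suc k = i" using False k assms by linarith
      then show False using k assms by (simp add: nx_def)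
    qed
    then show ?thesis using False k assms by (intro image_eqI[of _ _ "k + n - i"]) auto
  qed
next
  fix k assume "k \<in> (\<lambda>m. (i + m) mod n) ` {1..<n - 1}"
  then obtain m where m: "1 \<le> m" "m < n - 1" "k = (i + m) mod n" by auto
  then have "k = (if i + m < n then i + m else i + m - n)"
    using assms by (auto simp: mod_if)
  moreover have "nx k = (if Suc (i + m) < n then Suc (i + m) else Suc (i + m) - n)"
    using assms m by (auto simp: nx_def mod_Suc_eq mod_if)
  ultimately show "k \<in> away i" using m assms by (auto simp: away_def split: if_splits)
qed

lemma nx_mod: "nx ((i + m) mod n) = (i + Suc m) mod n"
  by (simp add: nx_def mod_Suc_eq)

text \<open>No side of the chain meets the frontier, so each lies wholly inside or wholly outside,
  and consecutive ones share a vertex. The first vertex of the chain is not interior, because the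
  frontier is met on the side from \<open>A i\<close> to it.\<close>

lemma away_sides_outside:
  assumes "i < n" "k \<in> away i"
  shows "side k \<inter> K i = {}"
proof -
  have miss: "side k \<inter> K i = {}" if "k \<in> away i" "A k \<notin> interior (K i)" for k
  proof (rule ccontr)
    assume "side k \<inter> K i \<noteq> {}"
    have fr: "frontier (K i) \<inter> side k = {}"
      using frontier_away[OF assms(1), of k] that(1) by (auto simp: away_def nx_def)
    then have "A k \<notin> K i" using that(2) frontier_K[OF assms(1)] by auto
    then have "side k \<inter> frontier (K i) \<noteq> {}"
      using \<open>side k \<inter> K i \<noteq> {}\<close> by (intro connected_Int_frontier) auto
    then show False using fr by auto
  qed
  have first: "A ((i + 1) mod n) \<notin> interior (K i)"
  proof
    assume "A ((i + 1) mod n) \<in> interior (K i)"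
    then have "closed_segment (A i) (A (Suc i mod n)) \<subseteq> interior (K i)"
      using vertex_interior[OF assms(1)] convex_interior[OF convex_K[OF assms(1)]]
      by (simp add: convex_contains_segment)
    then show False using foot_next[OF assms(1)] frontier_K[OF assms(1)] by blast
  qed
  have "A ((i + m) mod n) \<notin> interior (K i)" if "1 \<le> m" "m < n - 1" for m
    using that
  proof (induction m rule: dec_induct)
    case base then show ?case using first by simp
  next
    case (step m)
    then have "(i + m) mod n \<in> away i" using away_eq[OF assms(1)] by auto
    then have "A (nx ((i + m) mod n)) \<notin> K i" using miss step by auto
    then show ?case using nx_mod interior_subset by (metis subsetD)
  qed
  moreover obtain m where "1 \<le> m" "m < n - 1" "k = (i + m) mod n"
    using assms away_eq by auto
  ultimately show ?thesis using miss assms(2) by auto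
qed

lemma neighbour_in_away_side:
  assumes "neighbours i a b"
  obtains k where "k \<in> away i" "A a \<in> side k"
proof -
  have i: "i < n" using assms neighbours_def by simp
  note ix = index_cases[OF i]
  consider "a = nx i" | "a = pv i" using assms neighbours_def by auto
  then show ?thesis
  proof cases
    case 1
    have "nx (nx i) \<noteq> i" using ix index_cases(4)[OF ix(1)] by metis
    then show ?thesis using that[of "nx i"] 1 ix by (auto simp: away_def)
  next
    case 2
    note ix2 = index_cases[OF ix(2)]
    have "pv (pv i) \<noteq> i" using ix ix2 by metis
    then show ?thesis using that[of "pv (pv i)"] 2 ix ix2 by (auto simp: away_def)
  qed
qed

lemma other_vertex_not_in_K:
  assumes "i < n" "k < n" "k \<noteq> i"
  shows "A k \<notin> K i"
proof (cases "nx k = i")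
  case False
  then show ?thesis using away_sides_outside[of i k] assms by (auto simp: away_def)
next
  case True
  then have "neighbours i k (nx i)" using index_cases assms by (auto simp: neighbours_def)
  then show ?thesis using neighbour_in_away_side away_sides_outside assms by blast
qed

lemma connected_away:
  assumes "i < n"
  shows "connected (\<Union>k\<in>away i. side k)"
proof -
  have "connected (\<Union>m\<in>{1..<Suc l}. side ((i + m) mod n))" for l
  proof (induction l)
    case 0 then show ?case by simp
  next
    case (Suc l)
    show ?case
    proof (cases "l = 0")
      case True then show ?thesis by simp
    next
      case False
      have eq: "{1..<Suc (Suc l)} = insert (Suc l) {1..<Suc l}" by auto
      have "A ((i + Suc l) mod n) \<in> side ((i + l) mod n)" by (simp add: nx_mod)
      then have "A ((i + Suc l) mod n) \<in> (\<Union>m\<in>{1..<Suc l}. side ((i + m) mod n))"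
        using False by (intro UN_I[of l]) auto
      then have ne: "side ((i + Suc l) mod n) \<inter> (\<Union>m\<in>{1..<Suc l}. side ((i + m) mod n)) \<noteq> {}"
        by auto
      show ?thesis unfolding eq UN_insert by (rule connected_Un) (use Suc ne in auto)
    qed
  qed
  from this[of "n - 2"] show ?thesis
    using n_ge_3 unfolding away_eq[OF assms] by (simp add: numeral_2_eq_2 Suc_diff_Suc)
qed

lemma side_cases:
  assumes "i < n" "k < n"
  obtains (away) "k \<in> away i" | (adjacent) a b where "neighbours i a b" "side k = closed_segment (A i) (A a)"
proof -
  consider "k = i" | "nx k = i" | "k \<in> away i" using assms by (auto simp: away_def)
  then show ?thesis
  proof cases
    case 1 then show ?thesis using adjacent[of "nx i" "pv i"] assms by (simp add: neighbours_def)
  next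
    case 2
    then have "pv i = k" using index_cases assms by metis
    then show ?thesis using adjacent[of "pv i" "nx i"] 2 assms by (simp add: neighbours_def closed_segment_commute)
  next
    case 3 then show ?thesis by (rule away)
  qed
qed

section \<open>Nearest-point maps of the polygon and of the bodies\<close>

text \<open>Otherwise the projection of some point of the segment from \<open>A i\<close> to \<open>P\<close> would be a foot
  \<open>D\<close> on a side at \<open>A i\<close>, so this point would lie on the perpendicular to the side at \<open>D\<close>,
  which meets \<open>K i\<close> only in \<open>D\<close>.\<close>

lemma closest_point_region_in_K:
  assumes i: "i < n" and "P \<in> K i"
  shows "closest_point region P \<in> K i"
proof (rule ccontr)
  define g where "g = closest_point region"
  assume "\<not> ?thesis"
  then have gP: "g P \<notin> K i" by (simp add: g_def)
  have cont: "continuous_on S g" for S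
    unfolding g_def by (rule continuous_on_closest_point[OF convex_region closed_region region_nonempty])
  have g_self: "g y = y" if "y \<in> region" for y using that by (simp add: g_def closest_point_self)
  have "g ` closed_segment (A i) P \<inter> frontier (K i) \<noteq> {}"
  proof (rule connected_Int_frontier)
    show "connected (g ` closed_segment (A i) P)"
      by (intro connected_continuous_image cont) simp
    show "g ` closed_segment (A i) P \<inter> K i \<noteq> {}"
      using g_self vertex_in_region[OF i] vertex_in_K[OF i] by (force intro!: imageI[of "A i"])
    show "g ` closed_segment (A i) P - K i \<noteq> {}" using gP by auto
  qed
  then obtain x where x: "x \<in> closed_segment (A i) P" "g x \<in> frontier (K i)" by blast
  have xK: "x \<in> K i"
    using x(1) assms vertex_in_K convex_K convex_contains_segment by blast
  have gx: "g x \<in> K i" "g x \<notin> interior (K i)" using x(2) frontier_K[OF i] by auto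
  \<comment> \<open>A point of the polygon is fixed by \<open>g\<close>; then \<open>x\<close> would
    lie strictly between the interior point \<open>A i\<close> and \<open>P\<close>, hence be
    interior itself.\<close>
  have "x \<notin> region"
  proof
    assume "x \<in> region"
    then have "g x = x" by (rule g_self)
    then have "x \<noteq> A i" "x \<noteq> P" using gx gP vertex_interior[OF i] by auto
    then have "x \<in> open_segment (A i) P" using x(1) by (simp add: open_segment_def)
    then have "x \<in> interior (K i)"
      using in_interior_closure_convex_segment[OF convex_K vertex_interior] i assms closure_subset by blast
    then show False using gx \<open>g x = x\<close> by simp
  qed
  have gR: "g x \<in> region" unfolding g_def using closest_point_in_set[OF closed_region region_nonempty] .
  define \<nu> where "\<nu> = x - g x"
  have "\<nu> \<noteq> 0" using gR \<open>x \<notin> region\<close> by (auto simp: \<nu>_def)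
  have dot: "\<nu> \<bullet> (y - g x) \<le> 0" if "y \<in> region" for y
    using closest_point_dot[OF convex_region closed_region that, of x] by (simp add: \<nu>_def g_def)
  obtain k where k: "k < n" "g x \<in> side k"
    using supporting_line_side[OF \<open>\<nu> \<noteq> 0\<close>] gR dot by (metis diff_le_0_iff_le inner_diff_right)
  then obtain a b where nb: "neighbours i a b" and seg: "g x \<in> closed_segment (A i) (A a)"
    using side_cases[OF i k(1)] away_sides_outside[OF i] gx by blast
  obtain D where D: "frontier (K i) \<inter> closed_segment (A i) (A a) = {D}"
    "\<And>z. z \<in> K i \<Longrightarrow> (z - D) \<bullet> (A a - A i) \<le> 0" using foot[OF nb] by metis
  have "g x = D" using D(1) seg x(2) by blast
  define e where "e = A a - A i"
  obtain s where s: "0 \<le> s" "s \<le> 1" "D = (1 - s) *\<^sub>R A i + s *\<^sub>R A a"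
    using seg \<open>g x = D\<close> by (auto simp: in_segment)
  have a: "a < n" "a \<noteq> i" using neighbours_less[OF nb] by auto
  \<comment> \<open>\<open>D\<close> is neither end of the side, so \<open>\<nu>\<close>, being
    maximal on the side at \<open>D\<close>, is constant along it.\<close>
  have "s \<noteq> 0" using s gx \<open>g x = D\<close> vertex_interior[OF i] by auto
  have "s \<noteq> 1" using s gx \<open>g x = D\<close> other_vertex_not_in_K[OF i a] by auto
  have "A i - D = (- s) *\<^sub>R e" "A a - D = (1 - s) *\<^sub>R e" using s by (auto simp: e_def algebra_simps)
  then have "s * (\<nu> \<bullet> e) \<ge> 0" "(1 - s) * (\<nu> \<bullet> e) \<le> 0"
    using dot[OF vertex_in_region[OF i]] dot[OF vertex_in_region[OF a(1)]] \<open>g x = D\<close> by auto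
  then have "\<nu> \<bullet> e = 0"
    using s \<open>s \<noteq> 0\<close> \<open>s \<noteq> 1\<close> by (auto simp: zero_le_mult_iff mult_le_0_iff)
  have "x \<noteq> D" using gR \<open>x \<notin> region\<close> \<open>g x = D\<close> by auto
  then have mid: "midpoint x D \<in> interior (K i)" using strict_K[OF i xK] gx \<open>g x = D\<close> by auto
  have "e \<noteq> 0" using a vertex_in_K[OF i] other_vertex_not_in_K[OF i a] by (auto simp: e_def)
  then have "(midpoint x D - D) \<bullet> e < 0"
    using interior_inner_less[OF mid, of e D] D(2) by (auto simp: e_def)
  moreover have "midpoint x D - D = (1 / 2) *\<^sub>R \<nu>"
    by (simp add: \<nu>_def \<open>g x = D\<close> midpoint_def vec_eq_iff field_simps)
  ultimately show False using \<open>\<nu> \<bullet> e = 0\<close> by simp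
qed

text \<open>Projecting the nearest point onto the polygon keeps it in \<open>K i\<close> and brings
  it no farther from \<open>P\<close>; by uniqueness of the nearest point it has not moved.\<close>

lemma closest_point_K_in_region:
  assumes i: "i < n" and P: "P \<in> region"
  shows "closest_point (K i) P \<in> region"
proof -
  define p where "p = closest_point (K i) P"
  define q where "q = closest_point region p"
  have pK: "p \<in> K i" unfolding p_def by (rule closest_point_in_set[OF closed_K[OF i] K_nonempty[OF i]])
  have qK: "q \<in> K i" unfolding q_def by (rule closest_point_region_in_K[OF i pK])
  have "dist P q \<le> dist P p"
    using closest_point_lipschitz[OF convex_region closed_region region_nonempty, of P p]
      closest_point_self[OF P] by (simp add: q_def)
  moreover have "dist P p \<le> dist P z" if "z \<in> K i" for z
    unfolding p_def by (rule closest_point_le[OF closed_K[OF i] that])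
  ultimately have "q = p"
    unfolding p_def
    by (intro closest_point_unique[OF convex_K[OF i] closed_K[OF i] qK] ballI) (meson order_trans)
  then show ?thesis
    unfolding p_def[symmetric] q_def using closest_point_in_set[OF closed_region region_nonempty] by metis
qed

lemma infdist_closest_point_region_le:
  assumes i: "i < n"
  shows "infdist (closest_point region P) (K i) \<le> infdist P (K i)"
proof -
  define p where "p = closest_point (K i) P"
  have pK: "p \<in> K i" unfolding p_def by (rule closest_point_in_set[OF closed_K[OF i] K_nonempty[OF i]])
  have "infdist (closest_point region P) (K i) \<le> dist (closest_point region P) (closest_point region p)"
    by (rule infdist_le[OF closest_point_region_in_K[OF i pK]])
  also have "\<dots> \<le> dist P p"
    by (rule closest_point_lipschitz[OF convex_region closed_region region_nonempty])
  also have "\<dots> = infdist P (K i)"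
    using infdist_closest_point[OF closed_K[OF i] K_nonempty[OF i]] by (simp add: p_def)
  finally show ?thesis .
qed

text \<open>The body at the vertex before \<open>A k\<close> will do, as side \<open>k\<close> does
  not end there. Consequently the bodies cannot all meet one supporting line of the polygon at
  points of the polygon.\<close>

lemma no_common_side:
  assumes "k < n"
  obtains i where "i < n" "side k \<inter> K i = {}"
proof -
  note ix = index_cases[OF assms]
  have "k \<in> away (pv k)" using ix assms by (auto simp: away_def)
  then show ?thesis using that away_sides_outside ix by blast
qed

text \<open>If the projection kept the distance from \<open>P\<close> to \<open>p\<close>, then
  \<open>p'\<close> would lie on the supporting line at \<open>P'\<close>, hence on side
  \<open>k\<close>. A body that misses this side therefore gets strictly closer.\<close>

lemma infdist_closest_point_region_less:
  assumes "P \<notin> region"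
  obtains i where "i < n" "infdist (closest_point region P) (K i) < infdist P (K i)"
proof -
  define P' where "P' = closest_point region P"
  have P': "P' \<in> region" unfolding P'_def by (rule closest_point_in_set[OF closed_region region_nonempty])
  define \<nu> where "\<nu> = P - P'"
  have "\<nu> \<noteq> 0" using assms P' by (auto simp: \<nu>_def)
  have dot: "\<nu> \<bullet> (y - P') \<le> 0" if "y \<in> region" for y
    using closest_point_dot[OF convex_region closed_region that, of P] by (simp add: \<nu>_def P'_def)
  obtain k where k: "k < n"
    "\<And>x. x \<in> region \<Longrightarrow> (\<And>y. y \<in> region \<Longrightarrow> \<nu> \<bullet> y \<le> \<nu> \<bullet> x) \<Longrightarrow> x \<in> side k"
    using supporting_line_side[OF \<open>\<nu> \<noteq> 0\<close>] by metis
  obtain i where i: "i < n" "side k \<inter> K i = {}" using no_common_side[OF k(1)] by metis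
  define p where "p = closest_point (K i) P"
  define p' where "p' = closest_point region p"
  have pK: "p \<in> K i" unfolding p_def by (rule closest_point_in_set[OF closed_K[OF i(1)] K_nonempty[OF i(1)]])
  have p'K: "p' \<in> K i" unfolding p'_def by (rule closest_point_region_in_K[OF i(1) pK])
  have p': "p' \<in> region" unfolding p'_def by (rule closest_point_in_set[OF closed_region region_nonempty])
  have "dist P' p' < dist P p"
  proof (rule ccontr)
    assume "\<not> ?thesis"
    then have "\<nu> \<bullet> (p' - P') = 0"
      using closest_point_dist_eq[OF convex_region closed_region region_nonempty, of P p]
      by (simp add: P'_def p'_def \<nu>_def)
    then have "\<nu> \<bullet> y \<le> \<nu> \<bullet> p'" if "y \<in> region" for y
      using dot[OF that] by (simp add: inner_diff_right)
    then show False using k(2)[OF p'] i(2) p'K by blast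
  qed
  moreover have "infdist P' (K i) \<le> dist P' p'" by (rule infdist_le[OF p'K])
  moreover have "infdist P (K i) = dist P p"
    using infdist_closest_point[OF closed_K[OF i(1)] K_nonempty[OF i(1)]] by (simp add: p_def)
  ultimately show ?thesis using that[OF i(1)] by (simp add: P'_def)
qed

section \<open>Disjointness of the bodies inside the polygon\<close>

lemma path_to_away_sides:
  assumes j: "j < n" and y: "y \<in> region" "y \<in> frontier (K j)"
  obtains S where "connected S" "y \<in> S" "S \<subseteq> region - interior (K j)" "S \<inter> (\<Union>k\<in>away j. side k) \<noteq> {}"
proof -
  have yint: "y \<notin> interior (K j)" using y frontier_K[OF j] by auto
  then have ne: "y \<noteq> A j" using vertex_interior[OF j] by auto
  obtain B where B: "\<And>x. x \<in> region \<Longrightarrow> norm x \<le> B"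
    using compact_imp_bounded[OF compact_region] bounded_iff by blast
  have "B \<ge> 0" using B[OF y(1)] norm_ge_zero order_trans by blast
  \<comment> \<open>The path follows the ray from \<open>A j\<close> through \<open>y\<close>, which
    cannot re-enter the interior of \<open>K j\<close>. The constant \<open>c\<close> gives
    \<open>z\<close> a norm of at least \<open>B + 1\<close>, so the ray leaves the polygon before
    \<open>z\<close>.\<close>
  define c where "c = (B + norm y + 1) / norm (y - A j)"
  define z where "z = y + c *\<^sub>R (y - A j)"
  have c: "c > 0" using \<open>B \<ge> 0\<close> ne by (auto simp: c_def intro!: divide_pos_pos add_nonneg_pos)
  have yz: "y \<in> closed_segment (A j) z"
  proof -
    have "(1 - u) *\<^sub>R A j + u *\<^sub>R z = A j + (u * (1 + c)) *\<^sub>R (y - A j)" for u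
      by (simp add: z_def algebra_simps)
    from this[of "1 / (1 + c)"] have "y = (1 - 1 / (1 + c)) *\<^sub>R A j + (1 / (1 + c)) *\<^sub>R z"
      using c by simp
    then show ?thesis unfolding in_segment using c by (intro exI[of _ "1 / (1 + c)"]) auto
  qed
  have "z \<notin> region"
  proof
    assume "z \<in> region"
    have "norm (c *\<^sub>R (y - A j)) = B + norm y + 1" using ne \<open>B \<ge> 0\<close> by (simp add: c_def)
    moreover have "norm (c *\<^sub>R (y - A j)) \<le> norm z + norm y"
      using norm_triangle_ineq4[of z y] by (simp add: z_def)
    ultimately show False using B[OF \<open>z \<in> region\<close>] by simp
  qed
  have yz_int: "closed_segment y z \<inter> interior (K j) = {}"
    by (rule exit_segment_Int_interior[OF convex_K vertex_interior yint yz]) (use j in auto)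
  have "closed_segment y z \<inter> frontier region \<noteq> {}"
    by (rule connected_Int_frontier) (use y \<open>z \<notin> region\<close> in auto)
  then obtain e where e: "e \<in> closed_segment y z" "e \<in> frontier region" by blast
  have eR: "e \<in> region" "e \<notin> interior region" using e(2) closed_region by (auto simp: frontier_def)
  obtain \<nu> where \<nu>: "\<nu> \<noteq> 0" "\<And>x. x \<in> region \<Longrightarrow> \<nu> \<bullet> x \<le> \<nu> \<bullet> e"
    using supporting_hyperplane_not_interior[OF convex_region eR] by blast
  obtain k where k: "k < n" "e \<in> side k" using supporting_line_side[OF \<nu>(1)] eR(1) \<nu>(2) by blast
  have ye: "closed_segment y e \<subseteq> region" "closed_segment y e \<subseteq> closed_segment y z"
    using convex_region y(1) eR(1) e(1) convex_contains_segment by (blast, simp add: subset_closed_segment)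
  have e_int: "e \<notin> interior (K j)" using e(1) yz_int by blast
  show ?thesis
  proof (cases rule: side_cases[OF j k(1)])
    case 1
    show ?thesis
      by (rule that[of "closed_segment y e"]) (use 1 ye yz_int k(2) in auto)
  next
    \<comment> \<open>Here \<open>e\<close> lies on a side at \<open>A j\<close>. Continuing along
      that side to its far end \<open>A a\<close> again avoids the interior, and \<open>A a\<close>
      also belongs to a side away from \<open>A j\<close>.\<close>
    case (2 a b)
    have "closed_segment e (A a) \<inter> interior (K j) = {}"
      by (rule exit_segment_Int_interior[OF convex_K vertex_interior e_int]) (use j k 2 in auto)
    moreover have "A a \<in> (\<Union>k\<in>away j. side k)" using neighbour_in_away_side[OF 2(1)] by blast
    moreover have "closed_segment e (A a) \<subseteq> region"
      using convex_region eR(1) vertex_in_region neighbours_less[OF 2(1)]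
      by (simp add: convex_contains_segment)
    ultimately show ?thesis
      by (intro that[of "closed_segment y e \<union> closed_segment e (A a)"] connected_Un)
        (use ye yz_int in auto)
  qed
qed

text \<open>The arc of \<open>\<gamma> j\<close> in the polygon is the image of a connected set under the projection onto
  \<open>K j\<close>; it would meet both \<open>K i\<close> and its complement, hence the curve \<open>\<gamma> i\<close>.\<close>

lemma interiors_disjoint_in_region:
  assumes ij: "i < n" "j < n" "i \<noteq> j" and M: "M \<in> region" "M \<in> interior (K i)" "M \<in> interior (K j)"
  shows False
proof -
  \<comment> \<open>\<open>M\<close> is in \<open>K j\<close> and \<open>A i\<close> is not, so on
    the way the frontier of \<open>K j\<close> is met inside the interior of
    \<open>K i\<close>.\<close>
  have "closed_segment M (A i) \<inter> frontier (K j) \<noteq> {}"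
    by (rule connected_Int_frontier)
      (use M(3) interior_subset other_vertex_not_in_K[of j i] ij in \<open>auto intro!: exI[of _ M]\<close>)
  then obtain y where y: "y \<in> closed_segment M (A i)" "y \<in> frontier (K j)" by blast
  have yR: "y \<in> region"
    using y(1) M(1) vertex_in_region[OF ij(1)] convex_region convex_contains_segment by blast
  have yi: "y \<in> interior (K i)"
    using y(1) M(2) vertex_interior[OF ij(1)] convex_interior[OF convex_K[OF ij(1)]]
      convex_contains_segment by blast
  \<comment> \<open>The foot of \<open>K j\<close> on a side at \<open>A j\<close> that does not end
    at \<open>A i\<close> lies outside \<open>K i\<close>; the case split selects such a
    side.\<close>
  obtain z where z: "z \<in> frontier (K j)" "z \<in> region" "z \<notin> K i"
  proof (cases "nx j = i")
    case False
    then have "j \<in> away i" using ij by (auto simp: away_def)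
    then have "side j \<inter> K i = {}" using away_sides_outside[OF ij(1)] by blast
    moreover obtain D where "frontier (K j) \<inter> side j = {D}" using foot_next[OF ij(2)] nx_def by metis
    ultimately show ?thesis using that[of D] side_in_region[OF ij(2)] by blast
  next
    case True
    note ix = index_cases[OF ij(2)]
    have "pv j \<in> away i" using True ij ix by (auto simp: away_def)
    then have "side (pv j) \<inter> K i = {}" using away_sides_outside[OF ij(1)] by blast
    moreover have "neighbours j (pv j) (nx j)" using ij by (simp add: neighbours_def)
    then obtain D where "frontier (K j) \<inter> closed_segment (A j) (A (pv j)) = {D}" using foot by metis
    ultimately show ?thesis
      using that[of D] side_in_region[OF ix(2)] ix by (auto simp: closed_segment_commute)
  qed
  define E where "E = (\<Union>k\<in>away j. side k)"
  obtain S where S: "connected S" "y \<in> S" "S \<subseteq> region - interior (K j)" "S \<inter> E \<noteq> {}"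
    using path_to_away_sides[OF ij(2) yR y(2)] E_def by metis
  obtain T where T: "connected T" "z \<in> T" "T \<subseteq> region - interior (K j)" "T \<inter> E \<noteq> {}"
    using path_to_away_sides[OF ij(2) z(2,1)] E_def by metis
  have E: "connected E" "E \<subseteq> region - interior (K j)"
    using connected_away[OF ij(2)] away_sides_outside[OF ij(2)] side_in_region interior_subset
    by (auto simp: E_def away_def) blast+
  \<comment> \<open>\<open>U\<close> joins \<open>y\<close> to \<open>z\<close> in the polygon
    without entering the interior of \<open>K j\<close>. The projection onto \<open>K j\<close>
    fixes both points and sends \<open>U\<close> into the arc of the frontier in the
    polygon.\<close>
  define U where "U = (S \<union> E) \<union> T"
  have U: "connected U" "U \<subseteq> region - interior (K j)"
    using S T E by (auto simp: U_def intro!: connected_Un)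
  define g where "g = closest_point (K j)"
  have "connected (g ` U)"
    unfolding g_def
    by (intro connected_continuous_image U continuous_on_closest_point convex_K closed_K K_nonempty ij)
  have g_self: "g x = x" if "x \<in> frontier (K j)" for x
    using that frontier_K[OF ij(2)] by (simp add: g_def closest_point_self)
  have img: "g x \<in> region \<inter> frontier (K j)" if "x \<in> U" for x
  proof -
    have x: "x \<in> region" "x \<notin> interior (K j)" using that U by auto
    have "g x \<in> frontier (K j)"
    proof (cases "x \<in> K j")
      case True
      then show ?thesis using x frontier_K[OF ij(2)] by (simp add: g_def closest_point_self)
    next
      case False
      have gK: "g x \<in> K j" unfolding g_def by (rule closest_point_in_set[OF closed_K[OF ij(2)] K_nonempty[OF ij(2)]])
      have "g x \<notin> interior (K j)"
      proof
        assume "g x \<in> interior (K j)"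
        moreover have "(w - g x) \<bullet> (x - g x) \<le> 0" if "w \<in> K j" for w
          using closest_point_dot[OF convex_K[OF ij(2)] closed_K[OF ij(2)] that, of x]
          by (simp add: g_def inner_commute)
        ultimately have "(g x - g x) \<bullet> (x - g x) < 0"
          using gK False by (intro interior_inner_less[of _ "K j"]) auto
        then show False by simp
      qed
      then show ?thesis using gK frontier_K[OF ij(2)] by simp
    qed
    then show ?thesis using closest_point_K_in_region[OF ij(2) x(1)] by (simp add: g_def)
  qed
  have "g ` U \<inter> frontier (K i) \<noteq> {}"
  proof (rule connected_Int_frontier)
    show "connected (g ` U)" by fact
    have "y \<in> g ` U" "z \<in> g ` U" using g_self y(2) z(1) S(2) T(2) by (force simp: U_def)+
    then show "g ` U \<inter> K i \<noteq> {}" "g ` U - K i \<noteq> {}" using yi z(3) interior_subset by blast+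
  qed
  then show False using frontiers_disjoint[OF ij] img by blast
qed

section \<open>Existence and uniqueness of the minimizer\<close>

text \<open>A normal ray of \<open>K i\<close> starting at \<open>p\<close> cannot cross the side \<open>A i A b\<close> produced: the crossing
  point \<open>y\<close> would have both \<open>p\<close> and the foot on that side as nearest points in \<open>K i\<close>.\<close>

lemma normal_ray_stays_in_corner:
  assumes nb: "neighbours i a b"
    and v: "v \<bullet> (A a - A i) = 0" "v \<bullet> (A b - A i) > 0"
    and v': "v' \<bullet> (A b - A i) = 0" "v' \<bullet> (A a - A i) > 0" "\<And>x. x \<in> region \<Longrightarrow> v' \<bullet> (x - A i) \<ge> 0"
    and p: "p \<in> K i" "p + \<tau> *\<^sub>R u \<in> region" "\<tau> > 0"
    and normal: "\<And>x. x \<in> K i \<Longrightarrow> (x - p) \<bullet> u \<le> 0"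
    and \<nu>: "\<nu> \<bullet> u = 0" "\<nu> \<bullet> (A b - A i) \<le> 0" "\<nu> \<bullet> (p - A i) < 0"
  shows "v' \<bullet> u \<ge> 0"
proof (rule ccontr)
  assume "\<not> ?thesis"
  then have neg: "v' \<bullet> u < 0" by simp
  have i: "i < n" using nb neighbours_def by simp
  define e where "e = A b - A i"
  have "v' \<bullet> (p - A i) + \<tau> * (v' \<bullet> u) \<ge> 0"
    using v'(3)[OF p(2)] by (simp add: inner_diff_right inner_add_right algebra_simps)
  moreover have "\<tau> * (v' \<bullet> u) < 0" using neg p(3) by (simp add: mult_pos_neg)
  ultimately have pos: "v' \<bullet> (p - A i) > 0" by linarith
  \<comment> \<open>\<open>v'\<close> decreases along the ray and is still nonnegative at a later
    point, so it is positive at \<open>p\<close>; it vanishes at the parameter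
    \<open>\<sigma>\<close>, where the ray crosses the line of the side to
    \<open>A b\<close>.\<close>
  define \<sigma> where "\<sigma> = v' \<bullet> (p - A i) / (- (v' \<bullet> u))"
  have "\<sigma> > 0" using pos neg by (simp add: \<sigma>_def divide_pos_neg)
  define y where "y = p + \<sigma> *\<^sub>R u"
  have "v' \<bullet> (y - A i) = v' \<bullet> (p - A i) + \<sigma> * (v' \<bullet> u)"
    by (simp add: y_def inner_diff_right inner_add_right)
  then have "v' \<bullet> (y - A i) = 0" using neg by (simp add: \<sigma>_def)
  define t where "t = v \<bullet> (y - A i) / (v \<bullet> e)"
  have yt: "y - A i = t *\<^sub>R e"
    using two_normals_coordinates[of v "A a - A i" e v' "y - A i"] v v' \<open>v' \<bullet> (y - A i) = 0\<close>
    by (simp add: t_def e_def)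
  have "\<nu> \<bullet> (y - A i) < 0" using \<nu> by (simp add: y_def inner_diff_right inner_add_right)
  then have "t * (\<nu> \<bullet> e) < 0" using yt by simp
  then have "t > 0" using \<nu>(2) by (auto simp: e_def mult_less_0_iff)
  obtain D where D: "frontier (K i) \<inter> closed_segment (A i) (A b) = {D}"
    "\<And>x. x \<in> K i \<Longrightarrow> (x - D) \<bullet> e \<le> 0"
    using foot[of i b a] nb neighbours_sym unfolding e_def by metis
  then have "D \<in> closed_segment (A i) (A b)" "D \<in> K i" using frontier_K[OF i] by auto
  then obtain s where s: "0 \<le> s" "s \<le> 1" "D = (1 - s) *\<^sub>R A i + s *\<^sub>R A b" by (auto simp: in_segment)
  have Ds: "D - A i = s *\<^sub>R e" using s by (simp add: e_def algebra_simps)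
  have "u \<noteq> 0" using neg by auto
  then have "(y - p) \<bullet> u > 0" using \<open>\<sigma> > 0\<close> by (simp add: y_def)
  then have "y \<notin> K i" using normal by force
  \<comment> \<open>The segment from \<open>A i\<close> to the foot belongs to \<open>K i\<close>
    and \<open>y\<close> does not, so \<open>y\<close> lies at or beyond the foot.\<close>
  have "s \<le> t"
  proof (rule ccontr)
    assume "\<not> ?thesis"
    then have "t < s" "s > 0" using \<open>t > 0\<close> by auto
    have "y = A i + (t / s) *\<^sub>R (D - A i)" unfolding Ds using \<open>s > 0\<close> yt by (simp add: algebra_simps)
    then have "y = (1 - t / s) *\<^sub>R A i + (t / s) *\<^sub>R D" by (simp add: algebra_simps)
    then have "y \<in> closed_segment (A i) D"
      unfolding in_segment using \<open>t > 0\<close> \<open>s > 0\<close> \<open>t < s\<close> by (intro exI[of _ "t / s"]) auto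
    then show False
      using \<open>y \<notin> K i\<close> \<open>D \<in> K i\<close> vertex_in_K[OF i] convex_K[OF i] convex_contains_segment by blast
  qed
  \<comment> \<open>\<open>p\<close> and \<open>D\<close> both satisfy the nearest-point inequality
    for \<open>y\<close>, each tested at the other; the two left sides add up to the squared
    distance of \<open>p\<close> and \<open>D\<close>.\<close>
  have "y - D = (t - s) *\<^sub>R e" using yt Ds by (simp add: algebra_simps)
  then have "(p - D) \<bullet> (y - D) \<le> 0"
    using D(2)[OF p(1)] \<open>s \<le> t\<close> by (simp add: mult_nonneg_nonpos)
  moreover have "(D - p) \<bullet> (y - p) \<le> 0"
    using normal[OF \<open>D \<in> K i\<close>] \<open>\<sigma> > 0\<close> by (simp add: y_def mult_nonneg_nonpos)
  moreover have "(p - D) \<bullet> (y - D) + (D - p) \<bullet> (y - p) = (p - D) \<bullet> (p - D)"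
    by (simp add: algebra_simps inner_commute)
  ultimately have "(p - D) \<bullet> (p - D) \<le> 0" by linarith
  then have "p = D" using inner_ge_zero[of "p - D"] by (metis antisym inner_eq_zero_iff right_minus_eq)
  then have "v' \<bullet> (p - A i) = 0" using Ds v' by (simp add: e_def)
  then show False using pos by simp
qed

text \<open>\<open>\<nu>\<close> separates \<open>p\<close> from the line of the side, so
  \<open>p\<close> and the foot \<open>D\<close> would be distinct points of \<open>K i\<close>
  maximizing the same functional. Their midpoint is interior, which makes that impossible.\<close>

lemma normal_not_parallel_to_side:
  assumes nb: "neighbours i a b" and p: "p \<in> K i"
    and normal: "\<And>x. x \<in> K i \<Longrightarrow> (x - p) \<bullet> u \<le> 0" and u: "u = c *\<^sub>R (A a - A i)" "c > 0"
    and \<nu>: "\<nu> \<bullet> (A a - A i) = 0" "\<nu> \<bullet> (p - A i) < 0"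
  shows False
proof -
  have i: "i < n" using nb neighbours_def by simp
  define e where "e = A a - A i"
  obtain D where D: "frontier (K i) \<inter> closed_segment (A i) (A a) = {D}"
    "\<And>x. x \<in> K i \<Longrightarrow> (x - D) \<bullet> e \<le> 0"
    using foot[OF nb] unfolding e_def by metis
  then have DK: "D \<in> closed_segment (A i) (A a)" "D \<in> K i" using frontier_K[OF i] by auto
  then obtain s where s: "D = (1 - s) *\<^sub>R A i + s *\<^sub>R A a" by (auto simp: in_segment)
  have Ds: "D - A i = s *\<^sub>R e" using s by (simp add: e_def algebra_simps)
  have "p \<noteq> D" using \<nu> Ds by (auto simp: e_def)
  then have mid: "midpoint p D \<in> interior (K i)" using strict_K[OF i p DK(2)] by simp
  have "e \<noteq> 0"
    using vertex_in_K[OF i] other_vertex_not_in_K[OF i, of a] neighbours_less[OF nb] by (auto simp: e_def)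
  have np: "(x - p) \<bullet> e \<le> 0" if "x \<in> K i" for x
    using normal[OF that] u by (simp add: e_def mult_le_0_iff)
  have "(midpoint p D - D) \<bullet> e < 0" "(midpoint p D - p) \<bullet> e < 0"
    using interior_inner_less[OF mid \<open>e \<noteq> 0\<close>] D(2) np by blast+
  moreover have "(midpoint p D - D) \<bullet> e + (midpoint p D - p) \<bullet> e = 0"
    by (simp add: midpoint_def inner_add_left inner_diff_left field_simps)
  ultimately show False by linarith
qed

text \<open>In the oblique coordinates at \<open>A i\<close> both coefficients of \<open>u\<close>
  are nonnegative by \<open>normal_ray_stays_in_corner\<close>, while \<open>\<nu>\<close> has
  slopes at most 0 along the two sides and slope 0 along \<open>u\<close>. So \<open>u\<close> runs
  along a side on which \<open>\<nu>\<close> is constant, which leaves the case of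
  \<open>normal_not_parallel_to_side\<close>.\<close>

lemma no_normal_ray_below_top_vertex:
  assumes i: "i < n" and p: "p \<in> K i" "p \<in> region" "p + \<tau> *\<^sub>R u \<in> region" "\<tau> > 0" and "u \<noteq> 0"
    and normal: "\<And>x. x \<in> K i \<Longrightarrow> (x - p) \<bullet> u \<le> 0"
    and \<nu>: "\<nu> \<bullet> u = 0" "\<And>x. x \<in> region \<Longrightarrow> \<nu> \<bullet> x \<le> \<nu> \<bullet> A i" "\<nu> \<bullet> p < \<nu> \<bullet> A i"
  shows False
proof -
  define a b where "a = nx i" and "b = pv i"
  have nb: "neighbours i a b" using i by (simp add: neighbours_def a_def b_def)
  then have nb': "neighbours i b a" by (simp add: neighbours_sym)
  obtain v v' where v: "v \<bullet> (A a - A i) = 0" "v \<bullet> (A b - A i) > 0"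
    "v' \<bullet> (A b - A i) = 0" "v' \<bullet> (A a - A i) > 0"
    "\<And>x. x \<in> region \<Longrightarrow> v \<bullet> (x - A i) \<ge> 0" "\<And>x. x \<in> region \<Longrightarrow> v' \<bullet> (x - A i) \<ge> 0"
    using corner[OF nb] by metis
  note coord = two_normals_coordinates[of v "A a - A i" "A b - A i" v']
  define \<mu> \<mu>' where "\<mu> = \<nu> \<bullet> (A a - A i)" and "\<mu>' = \<nu> \<bullet> (A b - A i)"
  have \<mu>: "\<mu> \<le> 0" "\<mu>' \<le> 0"
    using \<nu>(2) vertex_in_region neighbours_less[OF nb] by (auto simp: \<mu>_def \<mu>'_def inner_diff_right)
  have below: "\<nu> \<bullet> (p - A i) < 0" using \<nu>(3) by (simp add: inner_diff_right)
  have "v' \<bullet> u \<ge> 0"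
    by (rule normal_ray_stays_in_corner[OF nb v(1-4,6) p(1,3,4) normal \<nu>(1) _ below])
      (use \<mu> \<mu>'_def in auto)
  moreover have "v \<bullet> u \<ge> 0"
    by (rule normal_ray_stays_in_corner[OF nb' v(3,4,1,2,5) p(1,3,4) normal \<nu>(1) _ below])
      (use \<mu> \<mu>_def in auto)
  moreover define \<alpha> \<beta> where "\<alpha> = v' \<bullet> u / (v' \<bullet> (A a - A i))" and "\<beta> = v \<bullet> u / (v \<bullet> (A b - A i))"
  ultimately have ab: "\<alpha> \<ge> 0" "\<beta> \<ge> 0" using v by auto
  have u: "u = \<alpha> *\<^sub>R (A a - A i) + \<beta> *\<^sub>R (A b - A i)" using coord[of u] v by (simp add: \<alpha>_def \<beta>_def)
  have "\<alpha> * \<mu> + \<beta> * \<mu>' = 0" using \<nu>(1) u by (simp add: \<mu>_def \<mu>'_def inner_add_right)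
  moreover have "\<alpha> * \<mu> \<le> 0" "\<beta> * \<mu>' \<le> 0" using ab \<mu> by (auto simp: mult_nonneg_nonpos)
  ultimately have zero: "\<alpha> * \<mu> = 0" "\<beta> * \<mu>' = 0" by linarith+
  have "\<mu> \<noteq> 0 \<or> \<mu>' \<noteq> 0"
  proof -
    have "\<nu> \<bullet> (p - A i) = (v' \<bullet> (p - A i) / (v' \<bullet> (A a - A i))) * \<mu> + (v \<bullet> (p - A i) / (v \<bullet> (A b - A i))) * \<mu>'"
      using arg_cong[OF coord[of "p - A i"], of "\<lambda>z. \<nu> \<bullet> z"] v by (simp add: inner_add_right \<mu>_def \<mu>'_def)
    then show ?thesis using below by auto
  qed
  then consider "\<alpha> = 0" "\<beta> > 0" "\<mu>' = 0" | "\<beta> = 0" "\<alpha> > 0" "\<mu> = 0"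
    using zero ab \<open>u \<noteq> 0\<close> u by (cases "\<alpha> = 0"; cases "\<beta> = 0") auto
  then show False
  proof cases
    case 1
    then show ?thesis
      using normal_not_parallel_to_side[OF nb' p(1) normal, of \<beta> \<nu>] u below by (simp add: \<mu>'_def)
  next
    case 2
    then show ?thesis
      using normal_not_parallel_to_side[OF nb p(1) normal, of \<alpha> \<nu>] u below by (simp add: \<mu>_def)
  qed
qed

section \<open>The weighted sum of distances and its minimizers\<close>

context
  fixes w :: "nat \<Rightarrow> real"
  assumes w_pos: "\<And>i. i < n \<Longrightarrow> w i > 0"
begin

abbreviation cost :: "real^2 \<Rightarrow> real" where
  "cost P \<equiv> \<Sum>i<n. w i * infdist P (K i)"

lemma minimizer_exists: "\<exists>P. \<forall>Q. cost P \<le> cost Q"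
proof -
  have "continuous_on region cost" by (intro continuous_intros)
  then obtain P where P: "P \<in> region" "\<And>Q. Q \<in> region \<Longrightarrow> cost P \<le> cost Q"
    using continuous_attains_inf[OF compact_region region_nonempty] by blast
  have "cost P \<le> cost Q" for Q
  proof -
    have "cost P \<le> cost (closest_point region Q)"
      by (rule P(2)[OF closest_point_in_set[OF closed_region region_nonempty]])
    also have "\<dots> \<le> cost Q"
      by (intro sum_mono mult_left_mono infdist_closest_point_region_le) (auto simp: less_imp_le w_pos)
    finally show ?thesis .
  qed
  then show ?thesis by blast
qed

lemma minimizer_in_region:
  assumes "\<And>Q. cost P \<le> cost Q"
  shows "P \<in> region"
proof (rule ccontr)
  assume "P \<notin> region"
  then obtain i where "i < n" "infdist (closest_point region P) (K i) < infdist P (K i)"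
    using infdist_closest_point_region_less by blast
  then have "cost (closest_point region P) < cost P"
    by (intro sum_strict_mono_ex1)
      (auto intro!: bexI[of _ i] mult_left_mono infdist_closest_point_region_le simp: less_imp_le w_pos)
  then show False using assms by (meson not_le)
qed

lemma minimizers_normal_rays:
  assumes min: "\<And>R. cost P \<le> cost R" "\<And>R. cost Q \<le> cost R" and "P \<noteq> Q" and i: "i < n"
  obtains (inside) "P \<in> K i" "Q \<in> K i"
    | (ray) p u a b where "p = closest_point (K i) P" "u = Q - P \<or> u = P - Q" "P = p + a *\<^sub>R u"
        "Q = p + b *\<^sub>R u" "0 \<le> a" "0 \<le> b" "\<And>x. x \<in> K i \<Longrightarrow> (x - p) \<bullet> u \<le> 0"
proof -
  define M where "M = midpoint P Q"
  \<comment> \<open>The weighted defect of midpoint convexity. Each defect is nonnegative, and their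
    sum is at most 0 because \<open>P\<close> and \<open>Q\<close> are minimizers; so none is
    positive.\<close>
  define gap where "gap k = w k * (infdist P (K k) + infdist Q (K k) - 2 * infdist M (K k))" for k
  have "0 \<le> gap k" if k: "k < n" for k
  proof -
    define p q where "p = closest_point (K k) P" and "q = closest_point (K k) Q"
    have "p \<in> K k" "q \<in> K k"
      unfolding p_def q_def by (rule closest_point_in_set[OF closed_K[OF k] K_nonempty[OF k]])+
    then have "midpoint p q \<in> K k"
      using convex_K[OF k] by (meson convex_contains_segment midpoint_in_closed_segment subsetD)
    then have "infdist M (K k) \<le> dist M (midpoint p q)" by (rule infdist_le)
    also have "\<dots> \<le> (dist P p + dist Q q) / 2" unfolding M_def by (rule dist_midpoints_le)

    finally show ?thesis
      using w_pos[OF k] infdist_closest_point[OF closed_K[OF k] K_nonempty[OF k]]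
      by (simp add: gap_def p_def q_def)
  qed
  moreover have "(\<Sum>k<n. gap k) = cost P + cost Q - 2 * cost M"
    by (simp add: gap_def algebra_simps sum.distrib sum_subtractf sum_distrib_left)
  then have "(\<Sum>k<n. gap k) \<le> 0" using min(1)[of M] min(2)[of M] by linarith
  ultimately have "gap i \<le> 0"
    using i member_le_sum[of i "{..<n}" gap] by (auto intro: order_trans)
  then have ge: "infdist P (K i) + infdist Q (K i) \<le> 2 * infdist (midpoint P Q) (K i)"
    using w_pos[OF i] by (simp add: gap_def M_def mult_le_0_iff)
  show ?thesis
  proof (rule infdist_midpoint_cases[OF convex_K[OF i] closed_K[OF i] K_nonempty[OF i] _ \<open>P \<noteq> Q\<close> ge])
    show "midpoint x y \<in> interior (K i)" if "x \<in> K i" "y \<in> K i" "x \<noteq> y" for x y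
      using strict_K[OF i that] .
  qed (fact inside, rule ray)
qed

lemma top_vertex_body_contains_minimizers:
  assumes min: "\<And>R. cost P \<le> cost R" "\<And>R. cost Q \<le> cost R" and "P \<noteq> Q"
    and \<nu>: "\<nu> \<noteq> 0" "\<nu> \<bullet> (Q - P) = 0"
  obtains i where "i < n" "P \<in> K i" "Q \<in> K i" "\<nu> \<bullet> P < \<nu> \<bullet> A i"
proof -
  have PQ: "P \<in> region" "Q \<in> region" using minimizer_in_region min by blast+
  note cases = minimizers_normal_rays[OF min \<open>P \<noteq> Q\<close>]
  obtain i where i: "i < n" "\<And>x. x \<in> region \<Longrightarrow> \<nu> \<bullet> x \<le> \<nu> \<bullet> A i" using maximal_vertex by blast
  have on_line: "\<exists>p. p \<in> K j \<and> p \<in> region \<and> \<nu> \<bullet> p = \<nu> \<bullet> P" if j: "j < n" for j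
  proof (cases rule: cases[OF j])
    case 1 then show ?thesis using PQ by blast
  next
    case (2 p u a b)
    have "p \<in> K j" "p \<in> region"
      unfolding 2(1) by (rule closest_point_in_set[OF closed_K[OF j] K_nonempty[OF j]],
        rule closest_point_K_in_region[OF j PQ(1)])
    moreover have "\<nu> \<bullet> u = 0" using 2(2) \<nu>(2) by (auto simp: inner_diff_right)
    then have "\<nu> \<bullet> P = \<nu> \<bullet> p" using arg_cong[OF 2(3), of "\<lambda>x. \<nu> \<bullet> x"] by (simp add: inner_add_right)
    ultimately show ?thesis by auto
  qed
  \<comment> \<open>If no vertex lay beyond the line PQ, it would be a supporting line of the
    polygon. By \<open>on_line\<close> every body would meet it in the polygon, against
    \<open>no_common_side\<close>.\<close>
  have below: "\<nu> \<bullet> P < \<nu> \<bullet> A i"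
  proof (rule ccontr)
    assume "\<not> ?thesis"
    then have top: "\<nu> \<bullet> y \<le> \<nu> \<bullet> P" if "y \<in> region" for y using i(2)[OF that] by linarith
    obtain k where k: "k < n"
      "\<And>x. x \<in> region \<Longrightarrow> (\<And>y. y \<in> region \<Longrightarrow> \<nu> \<bullet> y \<le> \<nu> \<bullet> x) \<Longrightarrow> x \<in> side k"
      using supporting_line_side[OF \<nu>(1)] by metis
    obtain j where j: "j < n" "side k \<inter> K j = {}" using no_common_side[OF k(1)] by metis
    then obtain p where p: "p \<in> K j" "p \<in> region" "\<nu> \<bullet> p = \<nu> \<bullet> P" using on_line by blast
    then have "p \<in> side k" using k(2) top by simp
    then show False using p(1) j(2) by blast
  qed
  show ?thesis
  proof (cases rule: cases[OF i(1)])
    case 1 then show ?thesis using that i(1) below by blast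
  next
    case (2 p u a b)
    have pK: "p \<in> K i" "p \<in> region"
      unfolding 2(1) by (rule closest_point_in_set[OF closed_K[OF i(1)] K_nonempty[OF i(1)]],
        rule closest_point_K_in_region[OF i(1) PQ(1)])
    have u0: "\<nu> \<bullet> u = 0" using 2(2) \<nu>(2) by (auto simp: inner_diff_right)
    have "u \<noteq> 0" using 2(2) \<open>P \<noteq> Q\<close> by auto
    have "\<nu> \<bullet> P = \<nu> \<bullet> p" using arg_cong[OF 2(3), of "\<lambda>x. \<nu> \<bullet> x"] u0 by (simp add: inner_add_right)
    then have pb: "\<nu> \<bullet> p < \<nu> \<bullet> A i" using below by simp
    \<comment> \<open>At least one of \<open>P\<close> and \<open>Q\<close> differs from
      \<open>p\<close> and supplies the point of the polygon at a positive parameter.\<close>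
    have "a \<noteq> b" using 2 \<open>P \<noteq> Q\<close> by metis
    then have "\<exists>\<tau>>0. p + \<tau> *\<^sub>R u \<in> region"
      using 2(3-6) PQ by (metis order_less_le)
    then show ?thesis
      using no_normal_ray_below_top_vertex[OF i(1) pK _ _ \<open>u \<noteq> 0\<close> 2(7) u0 i(2) pb] by blast
  qed
qed

lemma minimizer_unique:
  assumes min: "\<And>R. cost P \<le> cost R" "\<And>R. cost Q \<le> cost R"
  shows "P = Q"
proof (rule ccontr)
  assume ne: "P \<noteq> Q"
  have PQ: "P \<in> region" "Q \<in> region" using minimizer_in_region min by blast+
  \<comment> \<open>A quarter turn of \<open>Q - P\<close>. The vertices found for
    \<open>\<nu>\<close> and for \<open>- \<nu>\<close> lie strictly on opposite sides of the line
    PQ and are therefore distinct.\<close>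
  define \<nu> :: "real^2" where "\<nu> = vector [- ((Q - P) $ 2), (Q - P) $ 1]"
  have \<nu>: "\<nu> \<bullet> (Q - P) = 0" by (simp add: \<nu>_def inner_vec_def sum_2 algebra_simps)
  have "\<nu> \<noteq> 0" using ne by (auto simp: \<nu>_def vec_eq_iff forall_2)
  obtain i where i: "i < n" "P \<in> K i" "Q \<in> K i" "\<nu> \<bullet> P < \<nu> \<bullet> A i"
    using top_vertex_body_contains_minimizers[OF min ne \<open>\<nu> \<noteq> 0\<close> \<nu>] by metis
  obtain j where j: "j < n" "P \<in> K j" "Q \<in> K j" "- \<nu> \<bullet> P < - \<nu> \<bullet> A j"
    using top_vertex_body_contains_minimizers[OF min ne, of "- \<nu>"] \<open>\<nu> \<noteq> 0\<close> \<nu> by auto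
  have "i \<noteq> j" using i j by auto
  moreover have "midpoint P Q \<in> region"
    using convex_region PQ by (meson convex_contains_segment midpoint_in_closed_segment subsetD)
  ultimately show False
    using interiors_disjoint_in_region i j strict_K ne by metis
qed

end

end

text \<open>The value 0 for enclosed points turns the distance to the curve into the distance to the
  convex body, to which nearest-point arguments apply.\<close>

lemma curve_dist_frontier:
  assumes "compact K" "convex K" "K \<noteq> {}"
  shows "curve_dist P (frontier K) = infdist P K"
proof -
  have ins: "inside (frontier K) = interior K"
    using assms by (intro inside_frontier_eq_interior) (auto simp: compact_imp_bounded)
  have "K \<noteq> UNIV" using assms(1) not_compact_UNIV by auto
  then show ?thesis
    using assms ins infdist_frontier[of K P] interior_subset[of K]
    by (auto simp: curve_dist_def compact_imp_closed)
qed

theorem theorem1: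
  fixes n :: nat
    and A :: "nat \<Rightarrow> real^2"
    and \<gamma> :: "nat \<Rightarrow> (real^2) set"
    and w :: "nat \<Rightarrow> real"
  assumes "n \<ge> 3"
    and "convex_polygon n A"
    and "vertex_curves n A \<gamma>"
    and "\<And>i. i < n \<Longrightarrow> w i > 0"
  shows "\<exists>!P. \<forall>Q. (\<Sum>i<n. w i * curve_dist P (\<gamma> i)) \<le> (\<Sum>i<n. w i * curve_dist Q (\<gamma> i))"
proof -
  note vc = assms(3)[unfolded vertex_curves_def]
  have curve: "closed_convex_curve (\<gamma> i)" "A i \<in> inside (\<gamma> i)" if "i < n" for i using vc that by blast+
  have "\<exists>K. compact K \<and> convex K \<and> interior K \<noteq> {} \<and> \<gamma> i = frontier K" if "i < n" for i
    using curve(1)[OF that] unfolding closed_convex_curve_def by blast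
  then obtain K where K: "\<And>i. i < n \<Longrightarrow> compact (K i) \<and> convex (K i) \<and> interior (K i) \<noteq> {} \<and> \<gamma> i = frontier (K i)"
    by metis
  have gamma: "\<gamma> i = frontier (K i)" if "i < n" for i using K that by blast
  have ins: "A i \<in> interior (K i)" if "i < n" for i
    using curve[OF that] K[OF that] inside_frontier_eq_interior compact_imp_bounded by metis
  have halfspace: "\<exists>D. frontier (K i) \<inter> closed_segment (A i) b = {D} \<and> (\<forall>x\<in>K i. (x - D) \<bullet> (b - A i) \<le> 0)"
    if "i < n" "meets_side_orthogonally (\<gamma> i) (A i) b" for i b
  proof -
    have "meets_side_orthogonally (frontier (K i)) (A i) b" using that gamma by simp
    then obtain D where D: "frontier (K i) \<inter> closed_segment (A i) b = {D}"
      "((\<lambda>x. ((x - D) \<bullet> (b - A i)) / norm (x - D)) \<longlongrightarrow> 0) (at D within frontier (K i))"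
      unfolding meets_side_orthogonally_def by blast
    then have "D \<in> frontier (K i)" "D \<in> closed_segment (A i) b" by auto
    then show ?thesis
      using orthogonal_crossing_halfspace[of "K i" "A i" D b] K[OF that(1)] ins[OF that(1)] D
      by (auto simp: compact_imp_closed)
  qed
  interpret curved_polygon n A K
  proof
    show "midpoint x y \<in> interior (K i)" if "i < n" "x \<in> K i" "y \<in> K i" "x \<noteq> y" for i x y
    proof (rule midpoint_interior_if_no_collinear_triple)
      show "x = y \<or> y = z \<or> x = z"
        if "x \<in> frontier (K i)" "y \<in> frontier (K i)" "z \<in> frontier (K i)" "collinear {x, y, z}" for x y z
        using curve(1)[OF \<open>i < n\<close>] that
        unfolding closed_convex_curve_def gamma[OF \<open>i < n\<close>, symmetric] by blast
    qed (use that K compact_imp_closed in auto)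
  next
    fix i assume i: "i < n"
    then have "Suc i mod n < n" by simp
    then show "\<exists>D. frontier (K i) \<inter> closed_segment (A i) (A (Suc i mod n)) = {D} \<and>
        (\<forall>x\<in>K i. (x - D) \<bullet> (A (Suc i mod n) - A i) \<le> 0)"
      "\<exists>D. frontier (K (Suc i mod n)) \<inter> closed_segment (A (Suc i mod n)) (A i) = {D} \<and>
        (\<forall>x\<in>K (Suc i mod n). (x - D) \<bullet> (A i - A (Suc i mod n)) \<le> 0)"
      using vc i by (auto intro!: halfspace)
  next
    show "frontier (K i) \<inter> closed_segment (A k) (A (Suc k mod n)) = {}"
      if "i < n" "k < n" "k \<noteq> i" "Suc k mod n \<noteq> i" for i k
      unfolding gamma[OF that(1), symmetric] using vc that by blast
    show "frontier (K i) \<inter> frontier (K j) \<inter> polygon_region n A = {}"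
      if "i < n" "j < n" "i \<noteq> j" for i j
      unfolding gamma[OF that(1), symmetric] gamma[OF that(2), symmetric] using vc that by blast
  qed (use assms(2) K ins in auto)
  have eq: "(\<Sum>i<n. w i * curve_dist P (\<gamma> i)) = (\<Sum>i<n. w i * infdist P (K i))" for P
    using K K_nonempty by (intro sum.cong) (auto simp: curve_dist_frontier)
  obtain P where P: "\<forall>Q. (\<Sum>i<n. w i * infdist P (K i)) \<le> (\<Sum>i<n. w i * infdist Q (K i))"
    using minimizer_exists[of w] assms(4) by blast
  show ?thesis
    unfolding eq
  proof (rule ex1I[of _ P])
    show "Q = P" if "\<forall>R. (\<Sum>i<n. w i * infdist Q (K i)) \<le> (\<Sum>i<n. w i * infdist R (K i))" for Q
      by (rule minimizer_unique[of w]) (use P that assms(4) in auto)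
  qed (rule P)
qed

end
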